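(* Let $k$ be a field of characteristic $p>0$, let $V$ be a finite-dimensional $k$-vector space, and let $m$ be a positive integer divisible by $p$. Then for every $i\ge0$ the map $$\phi:\bigwedge^{i+1}V\otimes S_{m-i-1}(V)\to\bigwedge^{i+2}V\otimes S_{m-i-2}(V)$$ defined in the context descends to a well-defined map on quotients $$\phi:S_{(m-i,1^i)}(V)\to S_{(m-i-1,1^{i+1})}(V).$$
   Context: Hook Schur modules: let $\kappa_{a,b}:\bigwedge^bV\otimes S_a(V)\to\bigwedge^{b-1}V\otimes S_{a+1}(V)$ be the Koszul map (exterior comultiplication $\bigwedge^bV\to\bigwedge^{b-1}V\otimes V$ followed by symmetric multiplication). For $a\ge1$, $b\ge0$, $S_{(a,1^b)}(V)=\ker\kappa_{a,b}=\operatorname{im}\kappa_{a-1,b+1}\cong\operatorname{coker}\kappa_{a-2,b+2}$; here it is viewed as the quotient $\operatorname{coker}\kappa_{a-2,b+2}$ of $\bigwedge^{b+1}V\otimes S_{a-1}(V)$. Convention: $S_{(a,1^b)}(V)=0$ for $a\le0$, and $S_j(V)=0$ for $j<0$. The map $\phi:\bigwedge^rV\otimes S_j(V)\to\bigwedge^{r+1}V\otimes S_{j-1}(V)$ is symmetric comultiplication $S_j(V)\to V\otimes S_{j-1}(V)$ followed by exterior multiplication $\bigwedge^rV\otimes V\to\bigwedge^{r+1}V$. In a basis $v_1,\dots,v_n$ of $V$, with $v_I=v_{\ell_1}\wedge\cdots\wedge v_{\ell_r}$, $v^\alpha=v_1^{\alpha_1}\cdots v_n^{\alpha_n}$ and $\epsilon_t$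 the $t$-th standard vector, $\phi(v_I\otimes v^\alpha)=\sum_{t=1}^n\alpha_t\,v_I\wedge v_t\otimes v^{\alpha-\epsilon_t}$. *)

theory Defs
  imports "HOL-Algebra.AbelCoset" "Jordan_Normal_Form.VS_Connect" "HOL-Library.Poly_Mapping"
begin

text \<open>
  Vector spaces are module records over the field \<^term>\<open>class_ring\<close> given by the type
  \<open>'k\<close>. The fields \<open>mult\<close> and \<open>one\<close> of a module record play no role and
  are filled with zero.
\<close>

section \<open>Modules given by generators and relations\<close>

definition free_module :: "'x set \<Rightarrow> ('k::field, 'x \<Rightarrow>\<^sub>0 'k) module" where
  "free_module X =
     \<lparr>carrier = {f. Poly_Mapping.keys f \<subseteq> X}, mult = (\<lambda>_ _. 0), one = 0, zero = 0, add = (+),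
      smult = (\<lambda>c. Poly_Mapping.map ((*) c))\<rparr>"

text \<open>The scalar multiple of a coset is again a full coset, also when the scalar is zero.\<close>

definition quotient_module :: "('k::field, 'a) module \<Rightarrow> 'a set \<Rightarrow> ('k, 'a set) module" where
  "quotient_module M N =
     \<lparr>carrier = a_rcosets\<^bsub>M\<^esub> N, mult = (\<lambda>_ _. N), one = N, zero = N, add = set_add M,
      smult = (\<lambda>c A. \<Union>a\<in>A. N +>\<^bsub>M\<^esub> (c \<odot>\<^bsub>M\<^esub> a))\<rparr>"

definition relation_space :: "'x set \<Rightarrow> ('x \<Rightarrow>\<^sub>0 'k::field) set \<Rightarrow> ('x \<Rightarrow>\<^sub>0 'k) set" where
  "relation_space X R = LinearCombinations.module.span class_ring (free_module X) R"

definition presented_module ::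
    "'x set \<Rightarrow> ('x \<Rightarrow>\<^sub>0 'k::field) set \<Rightarrow> ('k, ('x \<Rightarrow>\<^sub>0 'k) set) module" where
  "presented_module X R = quotient_module (free_module X) (relation_space X R)"

definition generator ::
    "'x set \<Rightarrow> ('x \<Rightarrow>\<^sub>0 'k::field) set \<Rightarrow> 'x \<Rightarrow> ('x \<Rightarrow>\<^sub>0 'k) set" where
  "generator X R x = relation_space X R +>\<^bsub>free_module X\<^esub> Poly_Mapping.single x 1"

definition free_lift :: "('k::field, 'a) module \<Rightarrow> ('x \<Rightarrow> 'a) \<Rightarrow> ('x \<Rightarrow>\<^sub>0 'k) \<Rightarrow> 'a" where
  "free_lift P f q = (\<Oplus>\<^bsub>P\<^esub>x\<in>Poly_Mapping.keys q. Poly_Mapping.lookup q x \<odot>\<^bsub>P\<^esub> f x)"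

text \<open>
  The linear map from a presented module to \<open>P\<close> which sends the generator of \<open>x\<close> to
  \<open>f x\<close>. It is meaningful whenever \<open>f\<close> respects the relations, since then
  \<open>free_lift P f\<close> is constant on each coset.
\<close>

definition presented_lift ::
    "('k::field, 'a) module \<Rightarrow> ('x \<Rightarrow> 'a) \<Rightarrow> ('x \<Rightarrow>\<^sub>0 'k) set \<Rightarrow> 'a" where
  "presented_lift P f C = the_elem (free_lift P f ` C)"

section \<open>Tensor products\<close>

definition tensor_relations ::
    "('k::field, 'a) module \<Rightarrow> ('k, 'b) module \<Rightarrow> (('a \<times> 'b) \<Rightarrow>\<^sub>0 'k) set" where
  "tensor_relations M N =
     {Poly_Mapping.single (x \<oplus>\<^bsub>M\<^esub> x', y) 1 - Poly_Mapping.single (x, y) 1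
        - Poly_Mapping.single (x', y) 1 | x x' y.
        x \<in> carrier M \<and> x' \<in> carrier M \<and> y \<in> carrier N} \<union>
     {Poly_Mapping.single (x, y \<oplus>\<^bsub>N\<^esub> y') 1 - Poly_Mapping.single (x, y) 1
        - Poly_Mapping.single (x, y') 1 | x y y'.
        x \<in> carrier M \<and> y \<in> carrier N \<and> y' \<in> carrier N} \<union>
     {Poly_Mapping.single (c \<odot>\<^bsub>M\<^esub> x, y) 1 - Poly_Mapping.single (x, y) c | c x y.
        x \<in> carrier M \<and> y \<in> carrier N} \<union>
     {Poly_Mapping.single (x, c \<odot>\<^bsub>N\<^esub> y) 1 - Poly_Mapping.single (x, y) c | c x y.
        x \<in> carrier M \<and> y \<in> carrier N}"

definition tensor ::
    "('k::field, 'a) module \<Rightarrow> ('k, 'b) module \<Rightarrow> ('k, (('a \<times> 'b) \<Rightarrow>\<^sub>0 'k) set) module" where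
  "tensor M N = presented_module (carrier M \<times> carrier N) (tensor_relations M N)"

definition pure_tensor ::
    "('k::field, 'a) module \<Rightarrow> ('k, 'b) module \<Rightarrow> 'a \<Rightarrow> 'b \<Rightarrow> (('a \<times> 'b) \<Rightarrow>\<^sub>0 'k) set" where
  "pure_tensor M N x y = generator (carrier M \<times> carrier N) (tensor_relations M N) (x, y)"

definition tensor_lift ::
    "('k::field, 'c) module \<Rightarrow> ('a \<Rightarrow> 'b \<Rightarrow> 'c) \<Rightarrow> (('a \<times> 'b) \<Rightarrow>\<^sub>0 'k) set \<Rightarrow> 'c" where
  "tensor_lift P \<beta> = presented_lift P (\<lambda>(x, y). \<beta> x y)"

section \<open>Exterior and symmetric powers\<close>

text \<open>
  Degrees are integers. There are no tuples of negative length, so a power of negative degree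
  is presented by an empty set of generators and hence is zero.
\<close>

definition tuples :: "('k::field, 'v) module \<Rightarrow> int \<Rightarrow> 'v list set" where
  "tuples V r = {u. int (length u) = r \<and> set u \<subseteq> carrier V}"

definition multilinear_relations ::
    "('k::field, 'v) module \<Rightarrow> int \<Rightarrow> ('v list \<Rightarrow>\<^sub>0 'k) set" where
  "multilinear_relations V r =
     {Poly_Mapping.single (u[t := x \<oplus>\<^bsub>V\<^esub> y]) 1 - Poly_Mapping.single (u[t := x]) 1
        - Poly_Mapping.single (u[t := y]) 1 | u t x y.
        u \<in> tuples V r \<and> t < length u \<and> x \<in> carrier V \<and> y \<in> carrier V} \<union>
     {Poly_Mapping.single (u[t := c \<odot>\<^bsub>V\<^esub> x]) 1 - Poly_Mapping.single (u[t := x]) c | u t c x.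
        u \<in> tuples V r \<and> t < length u \<and> x \<in> carrier V}"

definition exterior_relations :: "('k::field, 'v) module \<Rightarrow> int \<Rightarrow> ('v list \<Rightarrow>\<^sub>0 'k) set" where
  "exterior_relations V r = multilinear_relations V r \<union>
     {Poly_Mapping.single u 1 | u s t.
        u \<in> tuples V r \<and> s < t \<and> t < length u \<and> u ! s = u ! t}"

definition symmetric_relations :: "('k::field, 'v) module \<Rightarrow> int \<Rightarrow> ('v list \<Rightarrow>\<^sub>0 'k) set" where
  "symmetric_relations V j = multilinear_relations V j \<union>
     {Poly_Mapping.single w 1 - Poly_Mapping.single (w[s := w ! t, t := w ! s]) 1 | w s t.
        w \<in> tuples V j \<and> s < t \<and> t < length w}"

definition ext_power :: "('k::field, 'v) module \<Rightarrow> int \<Rightarrow> ('k, ('v list \<Rightarrow>\<^sub>0 'k) set) module" where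
  "ext_power V r = presented_module (tuples V r) (exterior_relations V r)"

definition sym_power :: "('k::field, 'v) module \<Rightarrow> int \<Rightarrow> ('k, ('v list \<Rightarrow>\<^sub>0 'k) set) module" where
  "sym_power V j = presented_module (tuples V j) (symmetric_relations V j)"

definition wedge :: "('k::field, 'v) module \<Rightarrow> 'v list \<Rightarrow> ('v list \<Rightarrow>\<^sub>0 'k) set" where
  "wedge V u = generator (tuples V (int (length u))) (exterior_relations V (int (length u))) u"

definition sym_prod :: "('k::field, 'v) module \<Rightarrow> 'v list \<Rightarrow> ('v list \<Rightarrow>\<^sub>0 'k) set" where
  "sym_prod V w = generator (tuples V (int (length w))) (symmetric_relations V (int (length w))) w"

abbreviation ext_sym where
  "ext_sym V r j \<equiv> tensor (ext_power V r) (sym_power V j)"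

section \<open>Multiplications and comultiplications\<close>

definition omit :: "nat \<Rightarrow> 'a list \<Rightarrow> 'a list" where
  "omit t u = take t u @ drop (Suc t) u"

text \<open>
  \<open>\<And>\<^sup>r V \<rightarrow> \<And>\<^sup>r\<^sup>-\<^sup>1 V \<otimes> V\<close>; the sign is that of moving the factor at position \<open>t\<close>
  (counted from 0) to the last place.
\<close>

definition ext_comult ::
    "('k::field, 'v) module \<Rightarrow> int \<Rightarrow> ('v list \<Rightarrow>\<^sub>0 'k) set \<Rightarrow>
     ((('v list \<Rightarrow>\<^sub>0 'k) set \<times> 'v) \<Rightarrow>\<^sub>0 'k) set" where
  "ext_comult V r =
     (let T = tensor (ext_power V (r - 1)) V in
      presented_lift T (\<lambda>u. \<Oplus>\<^bsub>T\<^esub>t\<in>{..<length u}.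
        ((- 1) ^ (length u - Suc t)) \<odot>\<^bsub>T\<^esub> pure_tensor (ext_power V (r - 1)) V (wedge V (omit t u)) (u ! t)))"

definition ext_mult ::
    "('k::field, 'v) module \<Rightarrow> int \<Rightarrow> ('v list \<Rightarrow>\<^sub>0 'k) set \<Rightarrow> 'v \<Rightarrow> ('v list \<Rightarrow>\<^sub>0 'k) set" where
  "ext_mult V r x v = presented_lift (ext_power V (r + 1)) (\<lambda>u. wedge V (u @ [v])) x"

definition sym_comult ::
    "('k::field, 'v) module \<Rightarrow> int \<Rightarrow> ('v list \<Rightarrow>\<^sub>0 'k) set \<Rightarrow>
     (('v \<times> ('v list \<Rightarrow>\<^sub>0 'k) set) \<Rightarrow>\<^sub>0 'k) set" where
  "sym_comult V j =
     (let T = tensor V (sym_power V (j - 1)) in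
      presented_lift T (\<lambda>w. \<Oplus>\<^bsub>T\<^esub>t\<in>{..<length w}.
        pure_tensor V (sym_power V (j - 1)) (w ! t) (sym_prod V (omit t w))))"

definition sym_mult ::
    "('k::field, 'v) module \<Rightarrow> int \<Rightarrow> 'v \<Rightarrow> ('v list \<Rightarrow>\<^sub>0 'k) set \<Rightarrow> ('v list \<Rightarrow>\<^sub>0 'k) set" where
  "sym_mult V j v s = presented_lift (sym_power V (j + 1)) (\<lambda>w. sym_prod V (v # w)) s"

section \<open>The Koszul map, the map \<open>\<phi>\<close> and hook Schur modules\<close>

text \<open>
  \<open>koszul V a b\<close> is \<open>\<kappa>\<^sub>a\<^sub>,\<^sub>b\<close>, the composite of
  \<open>\<Delta> \<otimes> id : \<And>\<^sup>b V \<otimes> S\<^sub>a V \<rightarrow> \<And>\<^sup>b\<^sup>-\<^sup>1 V \<otimes> V \<otimes> S\<^sub>a V\<close> and \<open>id \<otimes> mult\<close>; the inner lift,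
  with \<open>s\<close> held fixed, takes care of the bracketing of the triple tensor product.
\<close>

definition koszul ::
    "('k::field, 'v) module \<Rightarrow> int \<Rightarrow> int \<Rightarrow>
     ((('v list \<Rightarrow>\<^sub>0 'k) set \<times> ('v list \<Rightarrow>\<^sub>0 'k) set) \<Rightarrow>\<^sub>0 'k) set \<Rightarrow>
     ((('v list \<Rightarrow>\<^sub>0 'k) set \<times> ('v list \<Rightarrow>\<^sub>0 'k) set) \<Rightarrow>\<^sub>0 'k) set" where
  "koszul V a b =
     tensor_lift (ext_sym V (b - 1) (a + 1)) (\<lambda>x s.
       tensor_lift (ext_sym V (b - 1) (a + 1)) (\<lambda>y v.
         pure_tensor (ext_power V (b - 1)) (sym_power V (a + 1)) y (sym_mult V a v s))
       (ext_comult V b x))"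

definition phi ::
    "('k::field, 'v) module \<Rightarrow> int \<Rightarrow> int \<Rightarrow>
     ((('v list \<Rightarrow>\<^sub>0 'k) set \<times> ('v list \<Rightarrow>\<^sub>0 'k) set) \<Rightarrow>\<^sub>0 'k) set \<Rightarrow>
     ((('v list \<Rightarrow>\<^sub>0 'k) set \<times> ('v list \<Rightarrow>\<^sub>0 'k) set) \<Rightarrow>\<^sub>0 'k) set" where
  "phi V r j =
     tensor_lift (ext_sym V (r + 1) (j - 1)) (\<lambda>x s.
       tensor_lift (ext_sym V (r + 1) (j - 1)) (\<lambda>v s'.
         pure_tensor (ext_power V (r + 1)) (sym_power V (j - 1)) (ext_mult V r x v) s')
       (sym_comult V j s))"

definition koszul_image where
  "koszul_image V a b = koszul V a b ` carrier (ext_sym V b a)"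

text \<open>
  The hook Schur module for the partition \<open>(a, 1\<^sup>b)\<close>, as the cokernel of
  \<open>\<kappa>\<^sub>a\<^sub>-\<^sub>2\<^sub>,\<^sub>b\<^sub>+\<^sub>2\<close>. It is the zero module for \<open>a \<le> 0\<close>, since then \<open>S\<^sub>a\<^sub>-\<^sub>1 V = 0\<close>.
\<close>

definition hook_schur where
  "hook_schur V a b = quotient_module (ext_sym V (b + 1) (a - 1)) (koszul_image V (a - 2) (b + 2))"

definition hook_proj where
  "hook_proj V a b x = koszul_image V (a - 2) (b + 2) +>\<^bsub>ext_sym V (b + 1) (a - 1)\<^esub> x"

end

theory Submission
  imports Defs
begin

text \<open>
  Write \<open>\<kappa>\<close> for the Koszul maps. On \<open>\<And>\<^sup>r V \<otimes> S\<^sub>j V\<close> the two composites satisfy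
  \<open>\<phi> \<kappa> + \<kappa> \<phi> = (r + j) \<cdot> id\<close>, which is lemma \<open>koszul_phi_homotopy\<close>. The module of the hook \<open>(m - i, 1\<^sup>i)\<close> is
  the quotient of \<open>\<And>\<^sup>i\<^sup>+\<^sup>1 V \<otimes> S\<^sub>m\<^sub>-\<^sub>i\<^sub>-\<^sub>1 V\<close> by the image of \<open>\<kappa>\<close> on \<open>\<And>\<^sup>i\<^sup>+\<^sup>2 V \<otimes> S\<^sub>m\<^sub>-\<^sub>i\<^sub>-\<^sub>2 V\<close>, where the total
  degree \<open>r + j\<close> is \<open>m\<close>. As \<open>p\<close> divides \<open>m\<close>, this is zero in the field, and \<open>\<phi> \<kappa> = - \<kappa> \<phi>\<close>. Hence \<open>\<phi>\<close> sends
  the image of \<open>\<kappa>\<close> into the image of the next \<open>\<kappa>\<close> (lemma \<open>phi_koszul_image\<close>), and so it induces a map of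
  the quotients.

  The homotopy identity is checked on monomials \<open>u \<otimes> w\<close>, given by a tuple \<open>u\<close> for the exterior part and
  a tuple \<open>w\<close> for the symmetric part. For this the maps \<open>\<kappa>\<close> and \<open>\<phi>\<close> have to be known as well-defined linear
  maps with the expected values on monomials (\<open>koszul_monomial\<close>, \<open>phi_monomial\<close>). All spaces are given by
  generators and relations, so this amounts to checking that each family prescribed on generators
  satisfies the relations. For the tensor product such families are the bilinear maps, and for the
  exterior and symmetric powers they are the alternating and the symmetric multilinear maps. The
  substantial cases are the comultiplications, in \<open>alternating_comult\<close> and \<open>symmetric_comult\<close>.

  There is no case distinction on the signs of the degrees: a power of negative degree has no
  generators, and statements that are checked on generators hold vacuously for it.
\<close>

section \<open>Vector spaces and linear maps\<close>

abbreviation vspace :: "('k::field, 'a) module \<Rightarrow> bool" where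
  "vspace M \<equiv> vectorspace class_ring M"

abbreviation lin :: "('k::field, 'a) module \<Rightarrow> ('k, 'b) module \<Rightarrow> ('a \<Rightarrow> 'b) \<Rightarrow> bool" where
  "lin M N f \<equiv> linear_map class_ring M N f"

lemma vsI:
  fixes M :: "('k::field, 'a) module"
  assumes "\<zero>\<^bsub>M\<^esub> \<in> carrier M"
    and "\<And>x y. \<lbrakk>x \<in> carrier M; y \<in> carrier M\<rbrakk> \<Longrightarrow> x \<oplus>\<^bsub>M\<^esub> y \<in> carrier M"
    and "\<And>x. x \<in> carrier M \<Longrightarrow> \<exists>y\<in>carrier M. x \<oplus>\<^bsub>M\<^esub> y = \<zero>\<^bsub>M\<^esub>"
    and "\<And>c x. x \<in> carrier M \<Longrightarrow> c \<odot>\<^bsub>M\<^esub> x \<in> carrier M"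
    and "\<And>x y. \<lbrakk>x \<in> carrier M; y \<in> carrier M\<rbrakk> \<Longrightarrow> x \<oplus>\<^bsub>M\<^esub> y = y \<oplus>\<^bsub>M\<^esub> x"
    and "\<And>x y z. \<lbrakk>x \<in> carrier M; y \<in> carrier M; z \<in> carrier M\<rbrakk> \<Longrightarrow>
      (x \<oplus>\<^bsub>M\<^esub> y) \<oplus>\<^bsub>M\<^esub> z = x \<oplus>\<^bsub>M\<^esub> (y \<oplus>\<^bsub>M\<^esub> z)"
    and "\<And>x. x \<in> carrier M \<Longrightarrow> x \<oplus>\<^bsub>M\<^esub> \<zero>\<^bsub>M\<^esub> = x"
    and "\<And>a b x. x \<in> carrier M \<Longrightarrow> (a * b) \<odot>\<^bsub>M\<^esub> x = a \<odot>\<^bsub>M\<^esub> (b \<odot>\<^bsub>M\<^esub> x)"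
    and "\<And>x. x \<in> carrier M \<Longrightarrow> 1 \<odot>\<^bsub>M\<^esub> x = x"
    and "\<And>a b x. x \<in> carrier M \<Longrightarrow> (a + b) \<odot>\<^bsub>M\<^esub> x = a \<odot>\<^bsub>M\<^esub> x \<oplus>\<^bsub>M\<^esub> b \<odot>\<^bsub>M\<^esub> x"
    and "\<And>a x y. \<lbrakk>x \<in> carrier M; y \<in> carrier M\<rbrakk> \<Longrightarrow>
      a \<odot>\<^bsub>M\<^esub> (x \<oplus>\<^bsub>M\<^esub> y) = a \<odot>\<^bsub>M\<^esub> x \<oplus>\<^bsub>M\<^esub> a \<odot>\<^bsub>M\<^esub> y"
  shows "vspace M"
proof -
  have "module class_ring M"
    by (rule module_criteria) (use assms class_cring.cring_axioms in \<open>auto\<close>)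
  then show ?thesis
    using class_field by (simp add: vectorspace_def)
qed

text \<open>
  The facts of the module locale speak of \<open>carrier\<close>, \<open>mult\<close> and \<open>one\<close> of \<^term>\<open>class_ring\<close>, which the
  simplifier evaluates before it can match them. Here they are restated with the operations of the
  type of scalars.
\<close>

context
  fixes M :: "('k::field, 'a) module"
  assumes vs: "vspace M"
begin

interpretation vectorspace class_ring M by (fact vs)

lemma vs_abelian_group: "abelian_group M" ..

lemma vs_module: "module class_ring M" ..

lemma vs_zero_closed [simp]: "\<zero>\<^bsub>M\<^esub> \<in> carrier M" by simp

lemma vs_add_closed [simp]: "x \<in> carrier M \<Longrightarrow> y \<in> carrier M \<Longrightarrow> x \<oplus>\<^bsub>M\<^esub> y \<in> carrier M" by simp

lemma vs_smult_closed [simp]: "x \<in> carrier M \<Longrightarrow> c \<odot>\<^bsub>M\<^esub> x \<in> carrier M"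
  using smult_closed[of c x] by simp

lemma vs_smult_add_left: "x \<in> carrier M \<Longrightarrow> (a + b) \<odot>\<^bsub>M\<^esub> x = a \<odot>\<^bsub>M\<^esub> x \<oplus>\<^bsub>M\<^esub> b \<odot>\<^bsub>M\<^esub> x"
  using smult_l_distr[of a b x] by simp

lemma vs_smult_add_right:
  "x \<in> carrier M \<Longrightarrow> y \<in> carrier M \<Longrightarrow> a \<odot>\<^bsub>M\<^esub> (x \<oplus>\<^bsub>M\<^esub> y) = a \<odot>\<^bsub>M\<^esub> x \<oplus>\<^bsub>M\<^esub> a \<odot>\<^bsub>M\<^esub> y"
  using smult_r_distr[of a x y] by simp

lemma vs_smult_assoc: "x \<in> carrier M \<Longrightarrow> a \<odot>\<^bsub>M\<^esub> (b \<odot>\<^bsub>M\<^esub> x) = (a * b) \<odot>\<^bsub>M\<^esub> x"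
  using smult_assoc1[of a b x] by simp

lemma vs_smult_one [simp]: "x \<in> carrier M \<Longrightarrow> 1 \<odot>\<^bsub>M\<^esub> x = x"
  using smult_one[of x] by simp

lemma vs_smult_zero_left [simp]: "x \<in> carrier M \<Longrightarrow> 0 \<odot>\<^bsub>M\<^esub> x = \<zero>\<^bsub>M\<^esub>"
  using smult_l_null[of x] by simp

lemma vs_smult_zero_right [simp]: "a \<odot>\<^bsub>M\<^esub> \<zero>\<^bsub>M\<^esub> = \<zero>\<^bsub>M\<^esub>"
  using smult_r_null[of a] by simp

lemma vs_smult_uminus: "x \<in> carrier M \<Longrightarrow> (- a) \<odot>\<^bsub>M\<^esub> x = \<ominus>\<^bsub>M\<^esub> (a \<odot>\<^bsub>M\<^esub> x)"
  using smult_l_minus[of a x] by (simp add: class_ring_simps)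

lemma vs_neg_eq_smult: "x \<in> carrier M \<Longrightarrow> \<ominus>\<^bsub>M\<^esub> x = (- 1) \<odot>\<^bsub>M\<^esub> x"
  by (simp add: vs_smult_uminus)

lemma vs_finsum_closed [simp]: "f \<in> A \<rightarrow> carrier M \<Longrightarrow> finsum M f A \<in> carrier M"
  by simp

lemma vs_smult_finsum:
  "f \<in> A \<rightarrow> carrier M \<Longrightarrow> c \<odot>\<^bsub>M\<^esub> finsum M f A = (\<Oplus>\<^bsub>M\<^esub>a\<in>A. c \<odot>\<^bsub>M\<^esub> f a)"
  by (induction A rule: infinite_finite_induct) (auto simp: Pi_def vs_smult_add_right)

lemma vs_minus_eq_zero_iff:
  "x \<in> carrier M \<Longrightarrow> y \<in> carrier M \<Longrightarrow> x \<ominus>\<^bsub>M\<^esub> y = \<zero>\<^bsub>M\<^esub> \<longleftrightarrow> x = y"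
  by (metis M.minus_eq M.r_neg M.minus_equality M.minus_minus M.a_comm M.a_inv_closed)

end

lemma lin_intro:
  fixes M :: "('k::field, 'a) module" and N :: "('k, 'b) module"
  assumes "vspace M" "vspace N"
    and "\<And>x. x \<in> carrier M \<Longrightarrow> f x \<in> carrier N"
    and "\<And>x y. \<lbrakk>x \<in> carrier M; y \<in> carrier M\<rbrakk> \<Longrightarrow> f (x \<oplus>\<^bsub>M\<^esub> y) = f x \<oplus>\<^bsub>N\<^esub> f y"
    and "\<And>c x. x \<in> carrier M \<Longrightarrow> f (c \<odot>\<^bsub>M\<^esub> x) = c \<odot>\<^bsub>N\<^esub> f x"
  shows "lin M N f"
  using assms
  by (auto simp: linear_map_def mod_hom_def mod_hom_axioms_def LinearCombinations.module_hom_def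
      vs_module)

context
  fixes M :: "('k::field, 'a) module" and N :: "('k, 'b) module" and f
  assumes lin: "lin M N f"
begin

interpretation linear_map class_ring M N f by (fact lin)

lemma lin_domain: "vspace M" ..

lemma lin_codomain: "vspace N" ..

lemma lin_closed: "x \<in> carrier M \<Longrightarrow> f x \<in> carrier N" by simp

lemma lin_add: "x \<in> carrier M \<Longrightarrow> y \<in> carrier M \<Longrightarrow> f (x \<oplus>\<^bsub>M\<^esub> y) = f x \<oplus>\<^bsub>N\<^esub> f y"
  by simp

lemma lin_smult: "x \<in> carrier M \<Longrightarrow> f (c \<odot>\<^bsub>M\<^esub> x) = c \<odot>\<^bsub>N\<^esub> f x"
  using T_smult[of c x] by simp

lemma lin_zero: "f \<zero>\<^bsub>M\<^esub> = \<zero>\<^bsub>N\<^esub>" by simp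

lemma lin_finsum: "g \<in> A \<rightarrow> carrier M \<Longrightarrow> f (finsum M g A) = (\<Oplus>\<^bsub>N\<^esub>a\<in>A. f (g a))"
  by (induction A rule: infinite_finite_induct) (auto simp: Pi_def)

lemma lin_kernel_submodule: "LinearCombinations.submodule class_ring {x \<in> carrier M. f x = \<zero>\<^bsub>N\<^esub>} M"
  using ker_is_submodule by (simp add: ker_def)

lemma lin_image_submodule: "LinearCombinations.submodule class_ring (f ` carrier M) N"
  using im_is_submodule by (simp add: im_def)

end

lemma lin_cong:
  assumes "lin M N f" "\<And>x. x \<in> carrier M \<Longrightarrow> g x = f x"
  shows "lin M N g"
  using assms lin_domain[OF assms(1)] lin_codomain[OF assms(1)]
  by (intro lin_intro) (simp_all add: lin_closed lin_add lin_smult)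

lemma lin_comp:
  assumes "lin M N f" "lin N P g"
  shows "lin M P (\<lambda>x. g (f x))"
  using lin_domain[OF assms(1)] lin_codomain[OF assms(2)] lin_closed[OF assms(1)]
    lin_closed[OF assms(2)]
  by (intro lin_intro)
    (simp_all add: lin_add[OF assms(1)] lin_add[OF assms(2)] lin_smult[OF assms(1)]
      lin_smult[OF assms(2)])

lemma lin_pointwise_add:
  assumes "lin M N f" "lin M N g"
  shows "lin M N (\<lambda>x. f x \<oplus>\<^bsub>N\<^esub> g x)"
proof -
  note vs = lin_domain[OF assms(1)] lin_codomain[OF assms(1)]
  interpret N: abelian_group N by (rule vs_abelian_group[OF vs(2)])
  show ?thesis
    using vs lin_closed[OF assms(1)] lin_closed[OF assms(2)]
    by (intro lin_intro)
      (simp_all add: lin_add[OF assms(1)] lin_add[OF assms(2)] lin_smult[OF assms(1)]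
        lin_smult[OF assms(2)] vs_smult_add_right N.add.m_ac)
qed

lemma lin_pointwise_smult:
  assumes "lin M N f"
  shows "lin M N (\<lambda>x. c \<odot>\<^bsub>N\<^esub> f x)"
  using lin_domain[OF assms(1)] lin_codomain[OF assms(1)] lin_closed[OF assms(1)]
  by (intro lin_intro)
    (simp_all add: lin_add[OF assms(1)] lin_smult[OF assms(1)] vs_smult_add_right
      vs_smult_assoc mult.commute)

lemma lin_const_zero:
  assumes "vspace M" "vspace N"
  shows "lin M N (\<lambda>x. \<zero>\<^bsub>N\<^esub>)"
proof -
  interpret N: abelian_group N by (rule vs_abelian_group[OF assms(2)])
  show ?thesis using assms by (intro lin_intro) auto
qed

lemma lin_ident: "vspace M \<Longrightarrow> lin M M (\<lambda>x. x)"
  by (rule lin_intro) auto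

lemma lin_pointwise_finsum:
  assumes "vspace M" "vspace N" "\<And>a. a \<in> A \<Longrightarrow> lin M N (f a)"
  shows "lin M N (\<lambda>x. \<Oplus>\<^bsub>N\<^esub>a\<in>A. f a x)"
proof -
  interpret N: abelian_group N by (rule vs_abelian_group[OF assms(2)])
  show ?thesis
    using assms(3)
  proof (induction A rule: infinite_finite_induct)
    case (insert a A)
    then have "lin M N (\<lambda>x. f a x \<oplus>\<^bsub>N\<^esub> (\<Oplus>\<^bsub>N\<^esub>a\<in>A. f a x))"
      by (intro lin_pointwise_add) auto
    then show ?case
      by (rule lin_cong) (use insert in \<open>auto intro!: N.finsum_insert intro: lin_closed\<close>)
  qed (use assms in \<open>auto intro: lin_const_zero\<close>)
qed

section \<open>Quotients\<close>

context
  fixes M :: "('k::field, 'a) module" and N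
  assumes vs: "vspace M" and sub: "LinearCombinations.submodule class_ring N M"
begin

interpretation M: vectorspace class_ring M by (fact vs)
interpretation N: LinearCombinations.submodule class_ring N M by (fact sub)

lemma submodule_abelian_subgroup: "abelian_subgroup N M"
proof (rule abelian_subgroupI3)
  have "\<ominus>\<^bsub>M\<^esub> x \<in> N" if "x \<in> N" for x
    using that N.smult_closed[of "- 1" x] N.subset vs_neg_eq_smult[OF vs, of x] by auto
  then show "additive_subgroup N M"
    using N.subset N.zero_closed
    by (auto intro!: additive_subgroupI M.add.subgroupI simp del: N.zero_closed)
qed (fact M.abelian_group_axioms)

interpretation A: abelian_subgroup N M by (rule submodule_abelian_subgroup)

lemma quotient_carrier: "carrier (quotient_module M N) = (\<lambda>x. N +>\<^bsub>M\<^esub> x) ` carrier M"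
  by (auto simp: quotient_module_def A_RCOSETS_def')

lemma coset_add:
  "x \<in> carrier M \<Longrightarrow> y \<in> carrier M \<Longrightarrow>
   (N +>\<^bsub>M\<^esub> x) \<oplus>\<^bsub>quotient_module M N\<^esub> (N +>\<^bsub>M\<^esub> y) = N +>\<^bsub>M\<^esub> (x \<oplus>\<^bsub>M\<^esub> y)"
  by (simp add: quotient_module_def A.a_rcos_sum)

lemma coset_eq_iff:
  assumes "x \<in> carrier M" "y \<in> carrier M"
  shows "N +>\<^bsub>M\<^esub> x = N +>\<^bsub>M\<^esub> y \<longleftrightarrow> x \<ominus>\<^bsub>M\<^esub> y \<in> N"
  using assms A.a_rcos_module[of y x] A.a_rcos_self[of x] A.a_repr_independence'[of x y]
  by (metis M.minus_eq)

lemma coset_zero: "\<zero>\<^bsub>quotient_module M N\<^esub> = N +>\<^bsub>M\<^esub> \<zero>\<^bsub>M\<^esub>"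
  using N.subset by (simp add: quotient_module_def)

lemma mem_coset: "y \<in> N +>\<^bsub>M\<^esub> x \<longleftrightarrow> (\<exists>n\<in>N. y = n \<oplus>\<^bsub>M\<^esub> x)"
  by (auto simp: a_r_coset_def')

text \<open>
  The union that defines the scalar multiple is over representatives of one coset, and all of them
  contribute the same coset.
\<close>

lemma coset_smult:
  assumes x: "x \<in> carrier M"
  shows "c \<odot>\<^bsub>quotient_module M N\<^esub> (N +>\<^bsub>M\<^esub> x) = N +>\<^bsub>M\<^esub> (c \<odot>\<^bsub>M\<^esub> x)"
proof -
  have "N +>\<^bsub>M\<^esub> (c \<odot>\<^bsub>M\<^esub> a) = N +>\<^bsub>M\<^esub> (c \<odot>\<^bsub>M\<^esub> x)" if a: "a \<in> N +>\<^bsub>M\<^esub> x" for a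
  proof -
    obtain n where n: "n \<in> N" "a = n \<oplus>\<^bsub>M\<^esub> x" using a by (auto simp: mem_coset)
    then have "c \<odot>\<^bsub>M\<^esub> a = c \<odot>\<^bsub>M\<^esub> n \<oplus>\<^bsub>M\<^esub> c \<odot>\<^bsub>M\<^esub> x" "c \<odot>\<^bsub>M\<^esub> n \<in> N" "n \<in> carrier M"
      using x N.subset vs N.smult_closed[of c n] by (auto simp: vs_smult_add_right)
    then have "c \<odot>\<^bsub>M\<^esub> a \<in> N +>\<^bsub>M\<^esub> (c \<odot>\<^bsub>M\<^esub> x)"
      by (auto simp: mem_coset)
    then show ?thesis
      using x vs by (metis A.a_repr_independence' vs_smult_closed)
  qed
  moreover have "x \<in> N +>\<^bsub>M\<^esub> x" using x by (rule A.a_rcos_self)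
  ultimately have "(\<Union>a\<in>N +>\<^bsub>M\<^esub> x. N +>\<^bsub>M\<^esub> (c \<odot>\<^bsub>M\<^esub> a)) = N +>\<^bsub>M\<^esub> (c \<odot>\<^bsub>M\<^esub> x)"
    by (intro UN_constant_eq[of x] ballI)
  then show ?thesis
    by (simp add: quotient_module_def)
qed

lemma vs_quotient: "vspace (quotient_module M N)"
proof (rule vsI, unfold quotient_carrier)
  show "\<zero>\<^bsub>quotient_module M N\<^esub> \<in> (\<lambda>x. N +>\<^bsub>M\<^esub> x) ` carrier M"
    unfolding coset_zero by blast
next
  fix x assume "x \<in> (\<lambda>x. N +>\<^bsub>M\<^esub> x) ` carrier M"
  then obtain a where a: "a \<in> carrier M" "x = N +>\<^bsub>M\<^esub> a" by blast
  show "\<exists>y\<in>(\<lambda>x. N +>\<^bsub>M\<^esub> x) ` carrier M. x \<oplus>\<^bsub>quotient_module M N\<^esub> y = \<zero>\<^bsub>quotient_module M N\<^esub>"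
    by (rule bexI[of _ "N +>\<^bsub>M\<^esub> (\<ominus>\<^bsub>M\<^esub> a)"]) (simp_all add: a coset_add coset_zero M.r_neg)
  show "x \<oplus>\<^bsub>quotient_module M N\<^esub> \<zero>\<^bsub>quotient_module M N\<^esub> = x"
    using coset_add[OF a(1) M.zero_closed] a(1) unfolding coset_zero a(2) by simp
  show "1 \<odot>\<^bsub>quotient_module M N\<^esub> x = x"
    using a vs by (simp only: coset_smult vs_smult_one)
  fix c d
  show "c \<odot>\<^bsub>quotient_module M N\<^esub> x \<in> (\<lambda>x. N +>\<^bsub>M\<^esub> x) ` carrier M"
    using a vs by (simp only: coset_smult vs_smult_closed image_eqI)
  show "(c * d) \<odot>\<^bsub>quotient_module M N\<^esub> x
      = c \<odot>\<^bsub>quotient_module M N\<^esub> (d \<odot>\<^bsub>quotient_module M N\<^esub> x)"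
    using a vs by (simp only: coset_smult vs_smult_closed vs_smult_assoc)
  show "(c + d) \<odot>\<^bsub>quotient_module M N\<^esub> x
      = c \<odot>\<^bsub>quotient_module M N\<^esub> x \<oplus>\<^bsub>quotient_module M N\<^esub> d \<odot>\<^bsub>quotient_module M N\<^esub> x"
    using a vs by (simp only: coset_smult coset_add vs_smult_closed vs_smult_add_left)
  fix y assume "y \<in> (\<lambda>x. N +>\<^bsub>M\<^esub> x) ` carrier M"
  then obtain b where b: "b \<in> carrier M" "y = N +>\<^bsub>M\<^esub> b" by blast
  show "x \<oplus>\<^bsub>quotient_module M N\<^esub> y \<in> (\<lambda>x. N +>\<^bsub>M\<^esub> x) ` carrier M"
    using a b by (simp only: coset_add M.a_closed image_eqI)
  show "x \<oplus>\<^bsub>quotient_module M N\<^esub> y = y \<oplus>\<^bsub>quotient_module M N\<^esub> x"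
    using a b by (simp only: coset_add M.a_comm)
  show "c \<odot>\<^bsub>quotient_module M N\<^esub> (x \<oplus>\<^bsub>quotient_module M N\<^esub> y)
      = c \<odot>\<^bsub>quotient_module M N\<^esub> x \<oplus>\<^bsub>quotient_module M N\<^esub> c \<odot>\<^bsub>quotient_module M N\<^esub> y"
    using a b vs by (simp only: coset_smult coset_add M.a_closed vs_smult_closed vs_smult_add_right)
  fix z assume "z \<in> (\<lambda>x. N +>\<^bsub>M\<^esub> x) ` carrier M"
  then obtain e where e: "e \<in> carrier M" "z = N +>\<^bsub>M\<^esub> e" by blast
  show "(x \<oplus>\<^bsub>quotient_module M N\<^esub> y) \<oplus>\<^bsub>quotient_module M N\<^esub> z
      = x \<oplus>\<^bsub>quotient_module M N\<^esub> (y \<oplus>\<^bsub>quotient_module M N\<^esub> z)"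
    using a b e by (simp only: coset_add M.a_closed M.a_assoc)
qed

lemma lin_quotient: "lin M (quotient_module M N) (\<lambda>x. N +>\<^bsub>M\<^esub> x)"
proof (rule lin_intro)
  show "N +>\<^bsub>M\<^esub> x \<in> carrier (quotient_module M N)" if "x \<in> carrier M" for x
    unfolding quotient_carrier using that by (rule imageI)
qed (simp_all only: vs vs_quotient coset_add coset_smult)

lemma coset_eq_zero_iff:
  assumes "x \<in> carrier M"
  shows "N +>\<^bsub>M\<^esub> x = \<zero>\<^bsub>quotient_module M N\<^esub> \<longleftrightarrow> x \<in> N"
proof -
  have "\<ominus>\<^bsub>M\<^esub> \<zero>\<^bsub>M\<^esub> = \<zero>\<^bsub>M\<^esub>"
    using vs by (simp only: vs_neg_eq_smult M.zero_closed vs_smult_zero_right)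
  then have "x \<ominus>\<^bsub>M\<^esub> \<zero>\<^bsub>M\<^esub> = x"
    using assms by (simp only: M.minus_eq M.r_zero)
  then show ?thesis
    using coset_eq_iff[OF assms M.zero_closed] by (simp only: coset_zero)
qed

end

text \<open>
  A linear map that kills \<open>N\<close> is constant on each coset of \<open>N\<close>; this is the factorization of such a map
  through the quotient.
\<close>

lemma the_elem_coset:
  assumes vs: "vspace M" and sub: "LinearCombinations.submodule class_ring N M"
    and lin: "lin M P f" and zero: "\<And>y. y \<in> N \<Longrightarrow> f y = \<zero>\<^bsub>P\<^esub>" and x: "x \<in> carrier M"
  shows "the_elem (f ` (N +>\<^bsub>M\<^esub> x)) = f x"
proof -
  interpret P: abelian_group P by (rule vs_abelian_group[OF lin_codomain[OF lin]])
  have N: "N \<subseteq> carrier M" using sub by (simp add: submodule_def)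
  have eq: "f y = f x" if y: "y \<in> N +>\<^bsub>M\<^esub> x" for y
  proof -
    obtain n where n: "n \<in> N" "y = n \<oplus>\<^bsub>M\<^esub> x" using y unfolding mem_coset[OF vs sub] by blast
    then have "f y = f n \<oplus>\<^bsub>P\<^esub> f x"
      using N lin_add[OF lin _ x, of n] by (simp only: subsetD)
    then show ?thesis using n zero x by (simp add: lin_closed[OF lin])
  qed
  have "x \<in> N +>\<^bsub>M\<^esub> x"
    using x by (rule abelian_subgroup.a_rcos_self[OF submodule_abelian_subgroup[OF vs sub]])
  then have "(\<lambda>_. f x) ` (N +>\<^bsub>M\<^esub> x) = {f x}" by (rule image_constant)
  moreover have "f ` (N +>\<^bsub>M\<^esub> x) = (\<lambda>_. f x) ` (N +>\<^bsub>M\<^esub> x)" by (rule image_cong[OF refl eq])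
  ultimately show ?thesis by simp
qed

lemma lin_quotient_lift:
  assumes vs: "vspace M" and sub: "LinearCombinations.submodule class_ring N M"
    and lin: "lin M P f" and zero: "\<And>y. y \<in> N \<Longrightarrow> f y = \<zero>\<^bsub>P\<^esub>"
  shows "lin (quotient_module M N) P (\<lambda>C. the_elem (f ` C))"
proof (rule lin_intro, unfold quotient_carrier[OF vs sub])
  note the_elem = the_elem_coset[OF vs sub lin zero]
  fix C assume "C \<in> (\<lambda>x. N +>\<^bsub>M\<^esub> x) ` carrier M"
  then obtain x where x: "x \<in> carrier M" "C = N +>\<^bsub>M\<^esub> x" by blast
  show "the_elem (f ` C) \<in> carrier P"
    using x by (simp only: the_elem lin_closed[OF lin])
  show "the_elem (f ` (c \<odot>\<^bsub>quotient_module M N\<^esub> C)) = c \<odot>\<^bsub>P\<^esub> the_elem (f ` C)" for c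
    using x vs by (simp only: coset_smult[OF vs sub] the_elem vs_smult_closed lin_smult[OF lin])
  fix D assume "D \<in> (\<lambda>x. N +>\<^bsub>M\<^esub> x) ` carrier M"
  then obtain y where y: "y \<in> carrier M" "D = N +>\<^bsub>M\<^esub> y" by blast
  show "the_elem (f ` (C \<oplus>\<^bsub>quotient_module M N\<^esub> D)) = the_elem (f ` C) \<oplus>\<^bsub>P\<^esub> the_elem (f ` D)"
    using x y vs by (simp only: coset_add[OF vs sub] the_elem vs_add_closed lin_add[OF lin])
qed (simp_all only: vs_quotient[OF vs sub] lin_codomain[OF lin])

section \<open>Modules given by generators and relations\<close>

lemma keys_subset_iff: "Poly_Mapping.keys q \<subseteq> X \<longleftrightarrow> (\<forall>x. Poly_Mapping.lookup q x \<noteq> 0 \<longrightarrow> x \<in> X)"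
  by (auto simp: in_keys_iff)

lemma free_module_carrier: "q \<in> carrier (free_module X) \<longleftrightarrow> Poly_Mapping.keys q \<subseteq> X"
  by (simp add: free_module_def)

lemma free_module_zero [simp]: "\<zero>\<^bsub>free_module X\<^esub> = 0"
  by (simp add: free_module_def)

lemma free_module_add [simp]: "q \<oplus>\<^bsub>free_module X\<^esub> q' = q + q'"
  by (simp add: free_module_def)

lemma lookup_free_module_smult:
  "Poly_Mapping.lookup (c \<odot>\<^bsub>free_module X\<^esub> q) x = c * Poly_Mapping.lookup q x"
  by (simp add: free_module_def map.rep_eq when_def)

lemma free_module_smult_single:
  "c \<odot>\<^bsub>free_module X\<^esub> Poly_Mapping.single x d = Poly_Mapping.single x (c * d)"
  by (simp add: free_module_def)

lemma vs_free_module: "vspace (free_module X :: ('k::field, 'x \<Rightarrow>\<^sub>0 'k) module)"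
proof (rule vsI)
  fix q :: "'x \<Rightarrow>\<^sub>0 'k" assume "q \<in> carrier (free_module X)"
  then show "\<exists>q'\<in>carrier (free_module X). q \<oplus>\<^bsub>free_module X\<^esub> q' = \<zero>\<^bsub>free_module X\<^esub>"
    by (intro bexI[of _ "- q"]) (auto simp: free_module_carrier keys_subset_iff)
next
  fix q q' :: "'x \<Rightarrow>\<^sub>0 'k"
  assume "q \<in> carrier (free_module X)" "q' \<in> carrier (free_module X)"
  then show "q \<oplus>\<^bsub>free_module X\<^esub> q' \<in> carrier (free_module X)"
    using Poly_Mapping.keys_add[of q q'] by (auto simp: free_module_carrier)
qed (auto simp: free_module_carrier keys_subset_iff lookup_free_module_smult lookup_add
    algebra_simps intro!: poly_mapping_eqI)

lemma single_in_free_module: "x \<in> X \<Longrightarrow> Poly_Mapping.single x c \<in> carrier (free_module X)"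
  by (auto simp: free_module_carrier)

lemma diff_in_free_module:
  "q \<in> carrier (free_module X) \<Longrightarrow> q' \<in> carrier (free_module X) \<Longrightarrow> q - q' \<in> carrier (free_module X)"
  using keys_diff[of q q'] by (auto simp: free_module_carrier)

lemma free_module_induct [consumes 1, case_names zero add single]:
  assumes "q \<in> carrier (free_module X)"
    and "Q 0"
    and "\<And>q q'. \<lbrakk>q \<in> carrier (free_module X); q' \<in> carrier (free_module X); Q q; Q q'\<rbrakk> \<Longrightarrow> Q (q + q')"
    and "\<And>x c. x \<in> X \<Longrightarrow> Q (Poly_Mapping.single x c)"
  shows "Q q"
  using assms(1)
proof (induction q rule: update_induct)
  case (update q x c)
  have eq: "Poly_Mapping.update x c q = q + Poly_Mapping.single x c"
    using update(1)
    by (intro poly_mapping_eqI) (auto simp: lookup_update lookup_add lookup_single in_keys_iff when_def)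
  have "x \<in> X" "q \<in> carrier (free_module X)"
    using update by (auto simp: free_module_carrier keys_update split: if_splits)
  then show ?case
    unfolding eq using update by (intro assms) (auto simp: single_in_free_module)
qed (use assms in auto)

context
  fixes P :: "('k::field, 'a) module" and X :: "'x set" and f
  assumes P: "vspace P" and f: "f \<in> X \<rightarrow> carrier P"
begin

interpretation P: vectorspace class_ring P by (fact P)

text \<open>
  A sum over the support of the argument is awkward for additivity, because the supports of \<open>q\<close>, \<open>q'\<close>
  and \<open>q + q'\<close> differ. Any finite set containing them all serves as a common index set.
\<close>

lemma free_lift_superset:
  assumes "finite A" "Poly_Mapping.keys q \<subseteq> A" "A \<subseteq> X"
  shows "free_lift P f q = (\<Oplus>\<^bsub>P\<^esub>x\<in>A. Poly_Mapping.lookup q x \<odot>\<^bsub>P\<^esub> f x)"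
  unfolding free_lift_def
  by (rule P.add.finprod_mono_neutral_cong_left)
    (use assms f P in \<open>auto simp: Pi_iff in_keys_iff subset_iff\<close>)

lemma free_lift_single: "x \<in> X \<Longrightarrow> free_lift P f (Poly_Mapping.single x c) = c \<odot>\<^bsub>P\<^esub> f x"
  using free_lift_superset[of "{x}" "Poly_Mapping.single x c"] f P by (auto simp: Pi_iff)

lemma lin_free_lift: "lin (free_module X) P (free_lift P f)"
proof (rule lin_intro)
  have f': "f x \<in> carrier P" if "x \<in> X" for x using f that by auto
  fix q :: "'x \<Rightarrow>\<^sub>0 'k" assume q: "q \<in> carrier (free_module X)"
  then have q': "Poly_Mapping.keys q \<subseteq> X" by (simp add: free_module_carrier)
  then show "free_lift P f q \<in> carrier P"
    unfolding free_lift_def using f' P by (intro P.finsum_closed) (auto simp: Pi_iff)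
  show "free_lift P f (c \<odot>\<^bsub>free_module X\<^esub> q) = c \<odot>\<^bsub>P\<^esub> free_lift P f q" for c
  proof -
    have "free_lift P f (c \<odot>\<^bsub>free_module X\<^esub> q)
        = (\<Oplus>\<^bsub>P\<^esub>x\<in>Poly_Mapping.keys q. (c * Poly_Mapping.lookup q x) \<odot>\<^bsub>P\<^esub> f x)"
      using q' by (subst free_lift_superset[of "Poly_Mapping.keys q"])
        (auto simp: lookup_free_module_smult in_keys_iff)
    also have "\<dots> = (\<Oplus>\<^bsub>P\<^esub>x\<in>Poly_Mapping.keys q. c \<odot>\<^bsub>P\<^esub> (Poly_Mapping.lookup q x \<odot>\<^bsub>P\<^esub> f x))"
      using q' f' P by (intro P.finsum_cong') (auto simp: vs_smult_assoc subset_iff)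
    also have "\<dots> = c \<odot>\<^bsub>P\<^esub> free_lift P f q"
      unfolding free_lift_def using q' f' P by (subst vs_smult_finsum) (auto simp: Pi_iff subset_iff)
    finally show ?thesis .
  qed
  fix q' :: "'x \<Rightarrow>\<^sub>0 'k" assume "q' \<in> carrier (free_module X)"
  then have q'': "Poly_Mapping.keys q' \<subseteq> X" by (simp add: free_module_carrier)
  let ?A = "Poly_Mapping.keys q \<union> Poly_Mapping.keys q'"
  have A: "?A \<subseteq> X" "finite ?A" using q' q'' by auto
  have "free_lift P f (q + q') = (\<Oplus>\<^bsub>P\<^esub>x\<in>?A. Poly_Mapping.lookup (q + q') x \<odot>\<^bsub>P\<^esub> f x)"
    using A Poly_Mapping.keys_add[of q q'] by (intro free_lift_superset)
  also have "\<dots> = (\<Oplus>\<^bsub>P\<^esub>x\<in>?A. Poly_Mapping.lookup q x \<odot>\<^bsub>P\<^esub> f x \<oplus>\<^bsub>P\<^esub> Poly_Mapping.lookup q' x \<odot>\<^bsub>P\<^esub> f x)"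
    using A f' P by (intro P.finsum_cong') (auto simp: lookup_add vs_smult_add_left subset_iff)
  also have "\<dots> = (\<Oplus>\<^bsub>P\<^esub>x\<in>?A. Poly_Mapping.lookup q x \<odot>\<^bsub>P\<^esub> f x)
      \<oplus>\<^bsub>P\<^esub> (\<Oplus>\<^bsub>P\<^esub>x\<in>?A. Poly_Mapping.lookup q' x \<odot>\<^bsub>P\<^esub> f x)"
    using A f' P by (intro P.finsum_addf) (auto simp: Pi_iff subset_iff)
  also have "(\<Oplus>\<^bsub>P\<^esub>x\<in>?A. Poly_Mapping.lookup q x \<odot>\<^bsub>P\<^esub> f x) = free_lift P f q"
    using A by (intro free_lift_superset[symmetric]) auto
  also have "(\<Oplus>\<^bsub>P\<^esub>x\<in>?A. Poly_Mapping.lookup q' x \<odot>\<^bsub>P\<^esub> f x) = free_lift P f q'"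
    using A by (intro free_lift_superset[symmetric]) auto
  finally show "free_lift P f (q \<oplus>\<^bsub>free_module X\<^esub> q') = free_lift P f q \<oplus>\<^bsub>P\<^esub> free_lift P f q'"
    by simp
qed (simp_all add: vs_free_module P)

lemma free_lift_diff:
  assumes "q \<in> carrier (free_module X)" "q' \<in> carrier (free_module X)"
  shows "free_lift P f (q - q') = free_lift P f q \<ominus>\<^bsub>P\<^esub> free_lift P f q'"
proof -
  have "free_lift P f q = free_lift P f ((q - q') \<oplus>\<^bsub>free_module X\<^esub> q')" by simp
  also have "\<dots> = free_lift P f (q - q') \<oplus>\<^bsub>P\<^esub> free_lift P f q'"
    by (intro lin_add[OF lin_free_lift] diff_in_free_module assms)
  finally show ?thesis
    using assms lin_closed[OF lin_free_lift] diff_in_free_module[OF assms]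
    by (simp add: P.minus_eq P.a_assoc P.r_neg)
qed

text \<open>
  The shapes of the defining relations of tensor products, exterior powers and symmetric powers:
  such a relation holds in \<open>P\<close> if and only if \<open>f\<close> satisfies the equation that the relation encodes.
\<close>

lemma free_lift_zero_iffs:
  assumes "x \<in> X" "y \<in> X" "z \<in> X"
  shows "free_lift P f (Poly_Mapping.single x 1) = \<zero>\<^bsub>P\<^esub> \<longleftrightarrow> f x = \<zero>\<^bsub>P\<^esub>"
    and "free_lift P f (Poly_Mapping.single x 1 - Poly_Mapping.single y c) = \<zero>\<^bsub>P\<^esub>
      \<longleftrightarrow> f x = c \<odot>\<^bsub>P\<^esub> f y"
    and "free_lift P f (Poly_Mapping.single x 1 - Poly_Mapping.single y 1 - Poly_Mapping.single z 1)
      = \<zero>\<^bsub>P\<^esub> \<longleftrightarrow> f x = f y \<oplus>\<^bsub>P\<^esub> f z"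
proof -
  note [simp] = P assms single_in_free_module diff_in_free_module free_lift_diff free_lift_single
    vs_minus_eq_zero_iff
  have [simp]: "f x \<in> carrier P" "f y \<in> carrier P" "f z \<in> carrier P"
    using f assms by auto
  show "free_lift P f (Poly_Mapping.single x 1) = \<zero>\<^bsub>P\<^esub> \<longleftrightarrow> f x = \<zero>\<^bsub>P\<^esub>"
    and "free_lift P f (Poly_Mapping.single x 1 - Poly_Mapping.single y c) = \<zero>\<^bsub>P\<^esub>
      \<longleftrightarrow> f x = c \<odot>\<^bsub>P\<^esub> f y"
    by simp_all
  have "f x \<ominus>\<^bsub>P\<^esub> f y \<ominus>\<^bsub>P\<^esub> f z = f x \<ominus>\<^bsub>P\<^esub> (f y \<oplus>\<^bsub>P\<^esub> f z)"
    by (simp add: P.minus_eq P.minus_add P.a_assoc)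
  then show "free_lift P f (Poly_Mapping.single x 1 - Poly_Mapping.single y 1 - Poly_Mapping.single z 1)
      = \<zero>\<^bsub>P\<^esub> \<longleftrightarrow> f x = f y \<oplus>\<^bsub>P\<^esub> f z"
    by simp
qed

end

text \<open>
  The universal property of a presentation concerns the families that satisfy its relations. The
  family of generators of the presented module is itself one of them. So one
  characterization of these families, for a given presentation, yields both the maps out of the
  presented module and the identities between its generators.
\<close>

definition satisfies :: "'x set \<Rightarrow> ('x \<Rightarrow>\<^sub>0 'k::field) set \<Rightarrow> ('k, 'a) module \<Rightarrow> ('x \<Rightarrow> 'a) \<Rightarrow> bool" where
  "satisfies X R P f \<longleftrightarrow> f \<in> X \<rightarrow> carrier P \<and> (\<forall>q\<in>R. free_lift P f q = \<zero>\<^bsub>P\<^esub>)"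

context
  fixes X :: "'x set" and R :: "('x \<Rightarrow>\<^sub>0 'k::field) set"
  assumes R: "R \<subseteq> carrier (free_module X)"
begin

lemma relation_space_submodule:
  "LinearCombinations.submodule class_ring (relation_space X R) (free_module X)"
  unfolding relation_space_def
  by (rule module.span_is_submodule[OF vs_module[OF vs_free_module] R])

lemma relation_space_subset:
  "LinearCombinations.submodule class_ring N (free_module X) \<Longrightarrow> R \<subseteq> N \<Longrightarrow> relation_space X R \<subseteq> N"
  unfolding relation_space_def
  by (rule module.span_is_subset[OF vs_module[OF vs_free_module]])

lemma relations_in_relation_space: "R \<subseteq> relation_space X R"
  unfolding relation_space_def
  by (rule module.in_own_span[OF vs_module[OF vs_free_module] R])

lemma vs_presented_module: "vspace (presented_module X R)"
  unfolding presented_module_def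
  by (rule vs_quotient[OF vs_free_module relation_space_submodule])

lemma lin_presented_proj:
  "lin (free_module X) (presented_module X R) (\<lambda>q. relation_space X R +>\<^bsub>free_module X\<^esub> q)"
  unfolding presented_module_def
  by (rule lin_quotient[OF vs_free_module relation_space_submodule])

lemma presented_carrier: "carrier (presented_module X R)
    = (\<lambda>q. relation_space X R +>\<^bsub>free_module X\<^esub> q) ` carrier (free_module X)"
  unfolding presented_module_def
  by (rule quotient_carrier[OF vs_free_module relation_space_submodule])

lemma generator_closed: "generator X R \<in> X \<rightarrow> carrier (presented_module X R)"
  by (auto simp: generator_def presented_carrier intro!: imageI single_in_free_module)

lemma coset_single:
  assumes x: "x \<in> X"
  shows "relation_space X R +>\<^bsub>free_module X\<^esub> Poly_Mapping.single x c
    = c \<odot>\<^bsub>presented_module X R\<^esub> generator X R x"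
  using lin_smult[OF lin_presented_proj single_in_free_module[OF x], of c 1]
  by (simp add: free_module_smult_single generator_def)

lemma presented_induct [consumes 1, case_names zero add smult generator]:
  assumes z: "z \<in> carrier (presented_module X R)"
    and zero: "Q \<zero>\<^bsub>presented_module X R\<^esub>"
    and add: "\<And>x y. \<lbrakk>x \<in> carrier (presented_module X R); y \<in> carrier (presented_module X R); Q x; Q y\<rbrakk>
      \<Longrightarrow> Q (x \<oplus>\<^bsub>presented_module X R\<^esub> y)"
    and smult: "\<And>c x. \<lbrakk>x \<in> carrier (presented_module X R); Q x\<rbrakk> \<Longrightarrow> Q (c \<odot>\<^bsub>presented_module X R\<^esub> x)"
    and gen: "\<And>x. x \<in> X \<Longrightarrow> Q (generator X R x)"
  shows "Q z"
proof -
  note proj = lin_presented_proj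
  obtain q where q: "q \<in> carrier (free_module X)" "z = relation_space X R +>\<^bsub>free_module X\<^esub> q"
    using z by (auto simp: presented_carrier)
  from q(1) have "Q (relation_space X R +>\<^bsub>free_module X\<^esub> q)"
  proof (induction q rule: free_module_induct)
    case zero
    show ?case using assms(2) lin_zero[OF proj] by simp
  next
    case (add q q')
    then show ?case using assms(3) lin_add[OF proj, of q q'] lin_closed[OF proj] by simp
  next
    case (single x c)
    have "generator X R x \<in> carrier (presented_module X R)"
      using generator_closed single by (rule funcset_mem)
    then show ?case
      unfolding coset_single[OF single] by (intro smult gen single)
  qed
  then show ?thesis using q by simp
qed

lemma lin_presented_eq:
  assumes "lin (presented_module X R) P g" "lin (presented_module X R) P h"
    and "\<And>x. x \<in> X \<Longrightarrow> g (generator X R x) = h (generator X R x)"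
    and "z \<in> carrier (presented_module X R)"
  shows "g z = h z"
  using assms(4)
  by (induction z rule: presented_induct)
    (simp_all add: assms(3) lin_zero[OF assms(1)] lin_zero[OF assms(2)] lin_add[OF assms(1)]
      lin_add[OF assms(2)] lin_smult[OF assms(1)] lin_smult[OF assms(2)])

lemma free_lift_generator:
  assumes "q \<in> carrier (free_module X)"
  shows "free_lift (presented_module X R) (generator X R) q = relation_space X R +>\<^bsub>free_module X\<^esub> q"
  using assms
proof (induction q rule: free_module_induct)
  note lift = lin_free_lift[OF vs_presented_module generator_closed] and proj = lin_presented_proj
  case zero
  show ?case using lin_zero[OF lift] lin_zero[OF proj] by simp
next
  note lift = lin_free_lift[OF vs_presented_module generator_closed] and proj = lin_presented_proj
  case (add q q')
  then show ?case using lin_add[OF lift, of q q'] lin_add[OF proj, of q q'] by simp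
next
  case (single x c)
  then show ?case
    by (simp only: coset_single free_lift_single[OF vs_presented_module generator_closed])
qed

lemma satisfies_generator: "satisfies X R (presented_module X R) (generator X R)"
proof -
  have "free_lift (presented_module X R) (generator X R) q = \<zero>\<^bsub>presented_module X R\<^esub>" if q: "q \<in> R" for q
  proof -
    have "q \<in> carrier (free_module X)" using R q by (rule subsetD)
    moreover have "q \<in> relation_space X R" using relations_in_relation_space q by (rule subsetD)
    ultimately show ?thesis
      using coset_eq_zero_iff[OF vs_free_module relation_space_submodule, of q]
      by (simp only: free_lift_generator) (simp only: presented_module_def)
  qed
  then show ?thesis using generator_closed by (simp add: satisfies_def)
qed

context
  fixes P :: "('k, 'a) module" and f
  assumes P: "vspace P" and f: "satisfies X R P f"
begin

lemma free_lift_relation_space: "q \<in> relation_space X R \<Longrightarrow> free_lift P f q = \<zero>\<^bsub>P\<^esub>"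
proof -
  have "lin (free_module X) P (free_lift P f)"
    using f by (intro lin_free_lift P) (simp add: satisfies_def)
  from lin_kernel_submodule[OF this] show "q \<in> relation_space X R \<Longrightarrow> free_lift P f q = \<zero>\<^bsub>P\<^esub>"
    using relation_space_subset f R unfolding satisfies_def by blast
qed

lemma lin_presented_lift: "lin (presented_module X R) P (presented_lift P f)"
proof -
  have "lin (free_module X) P (free_lift P f)"
    using f by (intro lin_free_lift P) (simp add: satisfies_def)
  then have "lin (presented_module X R) P (\<lambda>C. the_elem (free_lift P f ` C))"
    unfolding presented_module_def
    using free_lift_relation_space
    by (rule lin_quotient_lift[OF vs_free_module relation_space_submodule])
  then show ?thesis by (rule lin_cong) (simp only: presented_lift_def)
qed

lemma presented_lift_generator:
  assumes x: "x \<in> X"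
  shows "presented_lift P f (generator X R x) = f x"
proof -
  have f': "f \<in> X \<rightarrow> carrier P" using f by (simp add: satisfies_def)
  have "presented_lift P f (generator X R x) = free_lift P f (Poly_Mapping.single x 1)"
    unfolding presented_lift_def generator_def
    by (rule the_elem_coset[OF vs_free_module relation_space_submodule lin_free_lift[OF P f']
          free_lift_relation_space single_in_free_module[OF x]])
  then show ?thesis using f' x P by (auto simp: free_lift_single[OF P f'] Pi_iff)
qed

end

end

section \<open>Bilinear maps and tensor products\<close>

definition bilin ::
    "('k::field, 'a) module \<Rightarrow> ('k, 'b) module \<Rightarrow> ('k, 'c) module \<Rightarrow> ('a \<Rightarrow> 'b \<Rightarrow> 'c) \<Rightarrow> bool" where
  "bilin M N P \<beta> \<longleftrightarrow> (\<forall>x\<in>carrier M. lin N P (\<beta> x)) \<and> (\<forall>y\<in>carrier N. lin M P (\<lambda>x. \<beta> x y))"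

lemma bilinI:
  "(\<And>x. x \<in> carrier M \<Longrightarrow> lin N P (\<beta> x)) \<Longrightarrow> (\<And>y. y \<in> carrier N \<Longrightarrow> lin M P (\<lambda>x. \<beta> x y)) \<Longrightarrow>
   bilin M N P \<beta>"
  by (simp add: bilin_def)

lemma bilin_left: "bilin M N P \<beta> \<Longrightarrow> y \<in> carrier N \<Longrightarrow> lin M P (\<lambda>x. \<beta> x y)"
  by (simp add: bilin_def)

lemma bilin_right: "bilin M N P \<beta> \<Longrightarrow> x \<in> carrier M \<Longrightarrow> lin N P (\<beta> x)"
  by (simp add: bilin_def)

lemma bilin_swap: "bilin M N P \<beta> \<Longrightarrow> bilin N M P (\<lambda>y x. \<beta> x y)"
  by (simp add: bilin_def)

lemma bilin_closed: "bilin M N P \<beta> \<Longrightarrow> x \<in> carrier M \<Longrightarrow> y \<in> carrier N \<Longrightarrow> \<beta> x y \<in> carrier P"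
  by (blast dest: bilin_right lin_closed)

text \<open>
  Linearity in the second argument passes to sums and scalar multiples of the first argument, hence
  from generators to the whole presented module.
\<close>

lemma bilin_presentedI:
  assumes R: "R \<subseteq> carrier (free_module X)" and N: "vspace N" and P: "vspace P"
    and left: "\<And>y. y \<in> carrier N \<Longrightarrow> lin (presented_module X R) P (\<lambda>x. \<beta> x y)"
    and right: "\<And>g. g \<in> X \<Longrightarrow> lin N P (\<beta> (generator X R g))"
  shows "bilin (presented_module X R) N P \<beta>"
proof (rule bilinI)
  show "lin N P (\<beta> x)" if x: "x \<in> carrier (presented_module X R)" for x
    using x
  proof (induction x rule: presented_induct[OF R, consumes 1, case_names zero add smult generator])
    case zero
    show ?case
      by (rule lin_cong[OF lin_const_zero[OF N P]]) (rule lin_zero[OF left])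
  next
    case (add x y)
    show ?case
      by (rule lin_cong[OF lin_pointwise_add[OF add(3,4)]]) (rule lin_add[OF left add(1,2)])
  next
    case (smult c x)
    show ?case
      by (rule lin_cong[OF lin_pointwise_smult[OF smult(2)]]) (rule lin_smult[OF left smult(1)])
  qed (rule right)
qed (rule left)

lemma tensor_relations_subset:
  assumes "vspace M" "vspace N"
  shows "tensor_relations M N \<subseteq> carrier (free_module (carrier M \<times> carrier N))"
  unfolding tensor_relations_def using assms
  by (auto intro!: diff_in_free_module single_in_free_module)

lemma ball_setcompr3_iff:
  "(\<forall>q\<in>{h x y z | x y z. S x y z}. Q q) \<longleftrightarrow> (\<forall>x y z. S x y z \<longrightarrow> Q (h x y z))"
  by blast

lemma ball_setcompr4_iff:
  "(\<forall>q\<in>{h x y z w | x y z w. S x y z w}. Q q) \<longleftrightarrow> (\<forall>x y z w. S x y z w \<longrightarrow> Q (h x y z w))"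
  by blast

lemma satisfies_tensor_relations_iff:
  assumes vs: "vspace M" "vspace N" "vspace P"
  shows "satisfies (carrier M \<times> carrier N) (tensor_relations M N) P (\<lambda>(x, y). \<beta> x y)
    \<longleftrightarrow> bilin M N P \<beta>" (is "?satisfies \<longleftrightarrow> _")
proof -
  let ?X = "carrier M \<times> carrier N" and ?f = "\<lambda>(x, y). \<beta> x y"
  let ?closed = "?f \<in> ?X \<rightarrow> carrier P"
  have "?satisfies \<longleftrightarrow> ?closed \<and>
      (\<forall>x\<in>carrier M. \<forall>x'\<in>carrier M. \<forall>y\<in>carrier N. \<beta> (x \<oplus>\<^bsub>M\<^esub> x') y = \<beta> x y \<oplus>\<^bsub>P\<^esub> \<beta> x' y) \<and>
      (\<forall>x\<in>carrier M. \<forall>y\<in>carrier N. \<forall>y'\<in>carrier N. \<beta> x (y \<oplus>\<^bsub>N\<^esub> y') = \<beta> x y \<oplus>\<^bsub>P\<^esub> \<beta> x y') \<and>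
      (\<forall>c. \<forall>x\<in>carrier M. \<forall>y\<in>carrier N. \<beta> (c \<odot>\<^bsub>M\<^esub> x) y = c \<odot>\<^bsub>P\<^esub> \<beta> x y) \<and>
      (\<forall>c. \<forall>x\<in>carrier M. \<forall>y\<in>carrier N. \<beta> x (c \<odot>\<^bsub>N\<^esub> y) = c \<odot>\<^bsub>P\<^esub> \<beta> x y)"
  proof (cases ?closed)
    case True
    note iffs = free_lift_zero_iffs[OF vs(3) True]
    have 1: "free_lift P ?f (Poly_Mapping.single (x \<oplus>\<^bsub>M\<^esub> x', y) 1 - Poly_Mapping.single (x, y) 1
        - Poly_Mapping.single (x', y) 1) = \<zero>\<^bsub>P\<^esub> \<longleftrightarrow> \<beta> (x \<oplus>\<^bsub>M\<^esub> x') y = \<beta> x y \<oplus>\<^bsub>P\<^esub> \<beta> x' y"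
      if "x \<in> carrier M" "x' \<in> carrier M" "y \<in> carrier N" for x x' y
      using that vs by (subst iffs) auto
    have 2: "free_lift P ?f (Poly_Mapping.single (x, y \<oplus>\<^bsub>N\<^esub> y') 1 - Poly_Mapping.single (x, y) 1
        - Poly_Mapping.single (x, y') 1) = \<zero>\<^bsub>P\<^esub> \<longleftrightarrow> \<beta> x (y \<oplus>\<^bsub>N\<^esub> y') = \<beta> x y \<oplus>\<^bsub>P\<^esub> \<beta> x y'"
      if "x \<in> carrier M" "y \<in> carrier N" "y' \<in> carrier N" for x y y'
      using that vs by (subst iffs) auto
    have 3: "free_lift P ?f (Poly_Mapping.single (c \<odot>\<^bsub>M\<^esub> x, y) 1 - Poly_Mapping.single (x, y) c)
        = \<zero>\<^bsub>P\<^esub> \<longleftrightarrow> \<beta> (c \<odot>\<^bsub>M\<^esub> x) y = c \<odot>\<^bsub>P\<^esub> \<beta> x y"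
      if "x \<in> carrier M" "y \<in> carrier N" for c x y
      using that vs by (subst iffs) auto
    have 4: "free_lift P ?f (Poly_Mapping.single (x, c \<odot>\<^bsub>N\<^esub> y) 1 - Poly_Mapping.single (x, y) c)
        = \<zero>\<^bsub>P\<^esub> \<longleftrightarrow> \<beta> x (c \<odot>\<^bsub>N\<^esub> y) = c \<odot>\<^bsub>P\<^esub> \<beta> x y"
      if "x \<in> carrier M" "y \<in> carrier N" for c x y
      using that vs by (subst iffs) auto
    show ?thesis
      unfolding satisfies_def tensor_relations_def ball_Un ball_setcompr3_iff Ball_def[of "carrier _"]
      using True by (simp add: 1 2 3 4 imp_conjL cong: conj_cong)
  qed (simp add: satisfies_def)
  also have "\<dots> \<longleftrightarrow> bilin M N P \<beta>" (is "?L \<longleftrightarrow> ?R")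
  proof
    assume ?L
    then show ?R
      using vs by (auto simp: bilin_def Pi_iff intro!: lin_intro)
  next
    assume b: ?R
    show ?L
      by (auto simp: lin_add[OF bilin_left[OF b]] lin_add[OF bilin_right[OF b]]
          lin_smult[OF bilin_left[OF b]] lin_smult[OF bilin_right[OF b]] bilin_closed[OF b])
  qed
  finally show ?thesis .
qed

lemma vs_tensor: "vspace M \<Longrightarrow> vspace N \<Longrightarrow> vspace (tensor M N)"
  unfolding tensor_def by (intro vs_presented_module tensor_relations_subset)

lemma bilin_pure_tensor:
  assumes "vspace M" "vspace N"
  shows "bilin M N (tensor M N) (pure_tensor M N)"
proof -
  have "(\<lambda>(x, y). pure_tensor M N x y) = generator (carrier M \<times> carrier N) (tensor_relations M N)"
    by (auto simp: pure_tensor_def)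
  then show ?thesis
    using satisfies_tensor_relations_iff[OF assms vs_tensor[OF assms], of "pure_tensor M N"]
      satisfies_generator[OF tensor_relations_subset[OF assms]]
    by (simp add: tensor_def)
qed

context
  fixes M :: "('k::field, 'a) module" and N :: "('k, 'b) module" and P :: "('k, 'c) module" and \<beta>
  assumes vs: "vspace M" "vspace N" "vspace P" and bilin: "bilin M N P \<beta>"
begin

lemma lin_tensor_lift: "lin (tensor M N) P (tensor_lift P \<beta>)"
  unfolding tensor_def tensor_lift_def
  using bilin
  by (intro lin_presented_lift tensor_relations_subset vs)
    (simp add: satisfies_tensor_relations_iff[OF vs])

lemma tensor_lift_pure:
  assumes "x \<in> carrier M" "y \<in> carrier N"
  shows "tensor_lift P \<beta> (pure_tensor M N x y) = \<beta> x y"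
  unfolding pure_tensor_def tensor_lift_def
  using bilin assms presented_lift_generator[OF tensor_relations_subset[OF vs(1,2)] vs(3),
      of "\<lambda>(x, y). \<beta> x y" "(x, y)"]
  by (simp add: satisfies_tensor_relations_iff[OF vs])

end

text \<open>
  Pure tensors span the tensor product.
\<close>

lemma lin_tensor_eq:
  assumes vs: "vspace M" "vspace N" and g: "lin (tensor M N) P g" and h: "lin (tensor M N) P h"
    and "\<And>x y. \<lbrakk>x \<in> carrier M; y \<in> carrier N\<rbrakk> \<Longrightarrow> g (pure_tensor M N x y) = h (pure_tensor M N x y)"
    and "z \<in> carrier (tensor M N)"
  shows "g z = h z"
  by (rule lin_presented_eq[OF tensor_relations_subset[OF vs] g[unfolded tensor_def] h[unfolded tensor_def]])
    (use assms in \<open>auto simp: tensor_def pure_tensor_def\<close>)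

text \<open>
  Up to the order of the factors, this composes \<open>\<Delta> \<otimes> id : A \<otimes> D \<rightarrow> B \<otimes> C \<otimes> D\<close> with a trilinear map to \<open>P\<close>.
  The Koszul map and the map \<open>\<phi>\<close> have this form, with a comultiplication for \<open>\<Delta>\<close> and a trilinear map
  that comes from a multiplication.
\<close>

lemma bilin_comult_mult:
  assumes vs: "vspace B" "vspace C" "vspace D" and \<Delta>: "lin A (tensor B C) \<Delta>"
    and bc: "\<And>s. s \<in> carrier D \<Longrightarrow> bilin B C P (\<lambda>y v. \<gamma> y v s)"
    and d: "\<And>y v. y \<in> carrier B \<Longrightarrow> v \<in> carrier C \<Longrightarrow> lin D P (\<gamma> y v)"
    and P: "vspace P"
  shows "bilin A D P (\<lambda>x s. tensor_lift P (\<lambda>y v. \<gamma> y v s) (\<Delta> x))"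
proof -
  have left: "lin (tensor B C) P (tensor_lift P (\<lambda>y v. \<gamma> y v s))" if "s \<in> carrier D" for s
    using that by (intro lin_tensor_lift vs P bc)
  have "bilin (tensor B C) D P (\<lambda>z s. tensor_lift P (\<lambda>y v. \<gamma> y v s) z)"
    unfolding tensor_def
  proof (rule bilin_presentedI[OF tensor_relations_subset[OF vs(1,2)] vs(3) P])
    show "lin (presented_module (carrier B \<times> carrier C) (tensor_relations B C)) P
      (tensor_lift P (\<lambda>y v. \<gamma> y v s))" if "s \<in> carrier D" for s
      using left[OF that] by (simp only: tensor_def)
  next
    fix g assume "g \<in> carrier B \<times> carrier C"
    then obtain y v where g: "g = (y, v)" "y \<in> carrier B" "v \<in> carrier C" by blast
    have "tensor_lift P (\<lambda>y v. \<gamma> y v s) (pure_tensor B C y v) = \<gamma> y v s" if "s \<in> carrier D" for s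
      using that g by (intro tensor_lift_pure vs P bc)
    then show "lin D P (\<lambda>s. tensor_lift P (\<lambda>y v. \<gamma> y v s)
        (generator (carrier B \<times> carrier C) (tensor_relations B C) g))"
      unfolding g(1) pure_tensor_def[symmetric]
      by (intro lin_cong[OF d[OF g(2,3)]])
  qed
  then show ?thesis
    by (intro bilinI lin_comp[OF \<Delta>]) (blast dest: bilin_left bilin_right lin_closed[OF \<Delta>])+
qed

section \<open>Multilinear, alternating and symmetric maps\<close>

lemma tuples_update: "u \<in> tuples V r \<Longrightarrow> x \<in> carrier V \<Longrightarrow> u[t := x] \<in> tuples V r"
  by (auto simp: tuples_def dest!: set_update_subset_insert[THEN subsetD])

lemma tuples_nth: "u \<in> tuples V r \<Longrightarrow> t < length u \<Longrightarrow> u ! t \<in> carrier V"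
  by (auto simp: tuples_def subset_iff)

lemma length_omit [simp]: "t < length u \<Longrightarrow> length (omit t u) = length u - 1"
  by (simp add: omit_def)

lemma nth_omit:
  "t < length u \<Longrightarrow> k < length u - 1 \<Longrightarrow> omit t u ! k = (if k < t then u ! k else u ! Suc k)"
  by (auto simp: omit_def nth_append min_def)

lemma omit_append: "omit (length a) (a @ x # b) = a @ b"
  by (simp add: omit_def)

lemma omit_tuples: "u \<in> tuples V r \<Longrightarrow> t < length u \<Longrightarrow> omit t u \<in> tuples V (r - 1)"
  by (auto simp: tuples_def omit_def dest: in_set_takeD in_set_dropD)

lemma mset_omit:
  assumes "t < length u"
  shows "mset (omit t u) = mset u - {#u ! t#}"
proof -
  have "mset u = mset (take t u @ u ! t # drop (Suc t) u)"
    using id_take_nth_drop[OF assms] by metis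
  then show ?thesis by (simp add: omit_def)
qed

lemma omit_update_same: "omit t (u[t := x]) = omit t u"
  by (simp add: omit_def)

lemma omit_update:
  assumes "q < length u" "t < length u" "t \<noteq> q"
  shows "omit q (u[t := x]) = (omit q u)[(if t < q then t else t - 1) := x]"
  using assms by (intro nth_equalityI) (auto simp: nth_omit nth_list_update)

text \<open>
  Linearity in each place is stated as linearity of the one-place restrictions, so that the closure
  properties of linear maps under composition and pointwise sums apply directly. That \<open>f\<close> maps into
  the carrier is a separate condition because of the empty tuple, which has no places.
\<close>

definition multilin ::
    "('k::field, 'v) module \<Rightarrow> int \<Rightarrow> ('k, 'a) module \<Rightarrow> ('v list \<Rightarrow> 'a) \<Rightarrow> bool" where
  "multilin V r P f \<longleftrightarrow> f \<in> tuples V r \<rightarrow> carrier P \<and>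
     (\<forall>u\<in>tuples V r. \<forall>t<length u. lin V P (\<lambda>x. f (u[t := x])))"

definition alternating ::
    "('k::field, 'v) module \<Rightarrow> int \<Rightarrow> ('k, 'a) module \<Rightarrow> ('v list \<Rightarrow> 'a) \<Rightarrow> bool" where
  "alternating V r P f \<longleftrightarrow> multilin V r P f \<and>
     (\<forall>u\<in>tuples V r. \<forall>s t. s < t \<longrightarrow> t < length u \<longrightarrow> u ! s = u ! t \<longrightarrow> f u = \<zero>\<^bsub>P\<^esub>)"

definition symmetric ::
    "('k::field, 'v) module \<Rightarrow> int \<Rightarrow> ('k, 'a) module \<Rightarrow> ('v list \<Rightarrow> 'a) \<Rightarrow> bool" where
  "symmetric V r P f \<longleftrightarrow> multilin V r P f \<and>
     (\<forall>w\<in>tuples V r. \<forall>s t. s < t \<longrightarrow> t < length w \<longrightarrow> f w = f (w[s := w ! t, t := w ! s]))"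

lemma alternating_zero:
  "alternating V r P f \<Longrightarrow> u \<in> tuples V r \<Longrightarrow> s < t \<Longrightarrow> t < length u \<Longrightarrow> u ! s = u ! t \<Longrightarrow>
   f u = \<zero>\<^bsub>P\<^esub>"
  by (simp add: alternating_def)

lemma symmetric_swap:
  "symmetric V r P f \<Longrightarrow> w \<in> tuples V r \<Longrightarrow> s < t \<Longrightarrow> t < length w \<Longrightarrow>
   f w = f (w[s := w ! t, t := w ! s])"
  by (simp add: symmetric_def)

lemma multilin_closed: "multilin V r P f \<Longrightarrow> u \<in> tuples V r \<Longrightarrow> f u \<in> carrier P"
  by (auto simp: multilin_def)

lemma multilin_lin:
  "multilin V r P f \<Longrightarrow> u \<in> tuples V r \<Longrightarrow> t < length u \<Longrightarrow> lin V P (\<lambda>x. f (u[t := x]))"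
  by (auto simp: multilin_def)

lemma multilin_cong:
  assumes f: "multilin V r P f" and eq: "\<And>u. u \<in> tuples V r \<Longrightarrow> g u = f u"
  shows "multilin V r P g"
  unfolding multilin_def
proof (intro conjI ballI allI impI)
  show "g \<in> tuples V r \<rightarrow> carrier P" using f eq by (auto simp: multilin_def)
  fix u t assume u: "u \<in> tuples V r" "t < length u"
  show "lin V P (\<lambda>x. g (u[t := x]))"
    by (rule lin_cong[OF multilin_lin[OF f u]]) (simp add: eq tuples_update u)
qed

lemma alternating_cong:
  assumes "alternating V r P f" "\<And>u. u \<in> tuples V r \<Longrightarrow> g u = f u"
  shows "alternating V r P g"
  using assms multilin_cong[of V r P f g] unfolding alternating_def by metis

lemma symmetric_cong:
  assumes f: "symmetric V r P f" and eq: "\<And>u. u \<in> tuples V r \<Longrightarrow> g u = f u"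
  shows "symmetric V r P g"
  unfolding symmetric_def
proof (intro conjI ballI allI impI)
  show "multilin V r P g" using f eq multilin_cong[of V r P f g] unfolding symmetric_def by blast
  fix w s t assume w: "w \<in> tuples V r" "s < t" "t < length w"
  then have "w[s := w ! t, t := w ! s] \<in> tuples V r" by (simp add: tuples_update tuples_nth)
  then show "g w = g (w[s := w ! t, t := w ! s])"
    using f w unfolding symmetric_def by (simp add: eq)
qed

lemma multilin_append:
  assumes f: "multilin V (r + 1) P f" and v: "v \<in> carrier V"
  shows "multilin V r P (\<lambda>u. f (u @ [v]))"
  unfolding multilin_def
proof (intro conjI ballI allI impI)
  have app: "u @ [v] \<in> tuples V (r + 1)" if "u \<in> tuples V r" for u
    using that v by (simp add: tuples_def)
  then show "(\<lambda>u. f (u @ [v])) \<in> tuples V r \<rightarrow> carrier P"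
    using f by (simp add: multilin_closed)
  fix u t assume u: "u \<in> tuples V r" "t < length u"
  then show "lin V P (\<lambda>x. f (u[t := x] @ [v]))"
    using multilin_lin[OF f app[OF u(1)], of t] by (simp add: list_update_append1)
qed

lemma multilin_append_last:
  assumes f: "multilin V (r + 1) P f" and u: "u \<in> tuples V r" and V: "vspace V"
  shows "lin V P (\<lambda>v. f (u @ [v]))"
  using multilin_lin[OF f, of "u @ [\<zero>\<^bsub>V\<^esub>]" "length u"] u V by (simp add: tuples_def)

lemma multilin_Cons:
  assumes f: "multilin V (r + 1) P f" and v: "v \<in> carrier V"
  shows "multilin V r P (\<lambda>u. f (v # u))"
  unfolding multilin_def
proof (intro conjI ballI allI impI)
  have app: "v # u \<in> tuples V (r + 1)" if "u \<in> tuples V r" for u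
    using that v by (simp add: tuples_def)
  then show "(\<lambda>u. f (v # u)) \<in> tuples V r \<rightarrow> carrier P"
    using f by (simp add: multilin_closed)
  fix u t assume u: "u \<in> tuples V r" "t < length u"
  then show "lin V P (\<lambda>x. f (v # u[t := x]))"
    using multilin_lin[OF f app[OF u(1)], of "Suc t"] by simp
qed

lemma multilin_Cons_head:
  assumes f: "multilin V (r + 1) P f" and u: "u \<in> tuples V r" and V: "vspace V"
  shows "lin V P (\<lambda>v. f (v # u))"
  using multilin_lin[OF f, of "\<zero>\<^bsub>V\<^esub> # u" 0] u V by (simp add: tuples_def)

lemma multilin_finsum:
  assumes V: "vspace V" and P: "vspace P"
    and F: "\<And>q. int q < r \<Longrightarrow> multilin V r P (F q)"
  shows "multilin V r P (\<lambda>u. \<Oplus>\<^bsub>P\<^esub>q\<in>{..<length u}. F q u)"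
  unfolding multilin_def
proof (intro conjI ballI allI impI)
  have F': "multilin V r P (F q)" if "u \<in> tuples V r" "q < length u" for u q
    using that F by (auto simp: tuples_def)
  show "(\<lambda>u. \<Oplus>\<^bsub>P\<^esub>q\<in>{..<length u}. F q u) \<in> tuples V r \<rightarrow> carrier P"
    using P by (auto intro!: vs_finsum_closed intro: multilin_closed F')
  fix u t assume u: "u \<in> tuples V r" "t < length u"
  have "lin V P (\<lambda>x. \<Oplus>\<^bsub>P\<^esub>q\<in>{..<length u}. F q (u[t := x]))"
    by (rule lin_pointwise_finsum[OF V P]) (use u F' in \<open>auto intro: multilin_lin\<close>)
  then show "lin V P (\<lambda>x. \<Oplus>\<^bsub>P\<^esub>q\<in>{..<length (u[t := x])}. F q (u[t := x]))"
    by simp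
qed

lemma multilin_smult:
  "multilin V r P f \<Longrightarrow> vspace P \<Longrightarrow> multilin V r P (\<lambda>u. c \<odot>\<^bsub>P\<^esub> f u)"
  unfolding multilin_def by (auto simp: Pi_iff intro: lin_pointwise_smult)

text \<open>
  The typical summand of a comultiplication. Varying place \<open>q\<close> changes only the second argument of \<open>\<beta>\<close>,
  and varying any other place changes only the first.
\<close>

lemma multilin_omit:
  assumes f: "multilin V (r - 1) M f" and \<beta>: "bilin M V P \<beta>" and q: "int q < r"
  shows "multilin V r P (\<lambda>u. \<beta> (f (omit q u)) (u ! q))"
  unfolding multilin_def
proof (intro conjI ballI allI impI)
  have q': "q < length u" if "u \<in> tuples V r" for u using that q by (simp add: tuples_def)
  have omit: "f (omit q u) \<in> carrier M" if "u \<in> tuples V r" for u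
    using that q' by (intro multilin_closed[OF f] omit_tuples)
  show "(\<lambda>u. \<beta> (f (omit q u)) (u ! q)) \<in> tuples V r \<rightarrow> carrier P"
    by (intro funcsetI bilin_closed[OF \<beta>] omit tuples_nth q')
  fix u t assume u: "u \<in> tuples V r" "t < length u"
  show "lin V P (\<lambda>x. \<beta> (f (omit q (u[t := x]))) (u[t := x] ! q))"
  proof (cases "t = q")
    case True
    then show ?thesis
      using bilin_right[OF \<beta> omit[OF u(1)]] u q' by (simp add: omit_update_same)
  next
    case False
    let ?t = "if t < q then t else t - 1"
    have "?t < length (omit q u)" using False u q'[OF u(1)] by auto
    then have "lin V M (\<lambda>x. f ((omit q u)[?t := x]))"
      using u q' by (intro multilin_lin[OF f] omit_tuples)
    from lin_comp[OF this bilin_left[OF \<beta> tuples_nth[OF u(1) q'[OF u(1)]]]]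
    show ?thesis
      using False u q'[OF u(1)] by (simp add: omit_update)
  qed
qed

text \<open>
  Polarization: expand the value at a tuple with \<open>x + y\<close> in both places, which is zero, as are the two
  diagonal terms of the expansion.
\<close>

lemma alternating_swap:
  assumes f: "alternating V r P f" and V: "vspace V" and P: "vspace P"
    and u: "a @ x # y # b \<in> tuples V r"
  shows "f (a @ x # y # b) = \<ominus>\<^bsub>P\<^esub> f (a @ y # x # b)"
proof -
  interpret P: abelian_group P by (rule vs_abelian_group[OF P])
  let ?g = "\<lambda>x y. f (a @ x # y # b)"
  have mem: "a @ c # d # b \<in> tuples V r" if "c \<in> carrier V" "d \<in> carrier V" for c d
    using that u by (simp add: tuples_def)
  have f': "multilin V r P f" using f by (simp add: alternating_def)
  have xy: "x \<in> carrier V" "y \<in> carrier V" "x \<oplus>\<^bsub>V\<^esub> y \<in> carrier V"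
    using u V by (simp_all add: tuples_def)
  have left: "lin V P (\<lambda>c. ?g c d)" if "d \<in> carrier V" for d
    using multilin_lin[OF f' mem[OF xy(1) that], of "length a"] by simp
  have right: "lin V P (?g c)" if "c \<in> carrier V" for c
    using multilin_lin[OF f' mem[OF that xy(1)], of "Suc (length a)"] by (simp add: list_update_append)
  have closed: "?g c d \<in> carrier P" if "c \<in> carrier V" "d \<in> carrier V" for c d
    using that by (intro multilin_closed[OF f'] mem)
  have diag: "?g c c = \<zero>\<^bsub>P\<^esub>" if c: "c \<in> carrier V" for c
    using alternating_zero[OF f mem[OF c c], of "length a" "Suc (length a)"]
    by (simp add: nth_append)
  have "\<zero>\<^bsub>P\<^esub> = ?g (x \<oplus>\<^bsub>V\<^esub> y) (x \<oplus>\<^bsub>V\<^esub> y)"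
    using xy by (simp add: diag)
  also have "\<dots> = (?g x x \<oplus>\<^bsub>P\<^esub> ?g y x) \<oplus>\<^bsub>P\<^esub> (?g x y \<oplus>\<^bsub>P\<^esub> ?g y y)"
    using xy by (simp only: lin_add[OF left] lin_add[OF right])
  also have "\<dots> = ?g y x \<oplus>\<^bsub>P\<^esub> ?g x y"
    using xy by (simp only: diag closed P.l_zero P.r_zero)
  also have "\<dots> = ?g x y \<oplus>\<^bsub>P\<^esub> ?g y x"
    using xy by (simp only: closed P.a_comm)
  finally show ?thesis
    using xy closed by (metis P.minus_equality)
qed

text \<open>
  Each entry of \<open>b\<close> that \<open>x\<close> passes is an adjacent swap, at the cost of a sign.
\<close>

lemma alternating_move:
  assumes f: "alternating V r P f" and V: "vspace V" and P: "vspace P"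
    and u: "a @ x # b @ c \<in> tuples V r"
  shows "f (a @ x # b @ c) = (- 1) ^ length b \<odot>\<^bsub>P\<^esub> f (a @ b @ x # c)"
  using u
proof (induction b arbitrary: a)
  case Nil
  have "f (a @ x # c) \<in> carrier P"
    using f Nil by (auto simp: alternating_def intro: multilin_closed)
  then show ?case using P by simp
next
  case (Cons y b)
  have mem: "(a @ [y]) @ x # b @ c \<in> tuples V r" "(a @ [y]) @ b @ x # c \<in> tuples V r"
    using Cons.prems by (auto simp: tuples_def)
  then have closed: "f ((a @ [y]) @ b @ x # c) \<in> carrier P"
    using f by (auto simp: alternating_def intro: multilin_closed)
  have "f (a @ x # (y # b) @ c) = \<ominus>\<^bsub>P\<^esub> f ((a @ [y]) @ x # b @ c)"
    using alternating_swap[OF f V P, of a x y "b @ c"] Cons.prems by simp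
  also have "\<dots> = (- 1) ^ length (y # b) \<odot>\<^bsub>P\<^esub> f (a @ (y # b) @ x # c)"
    using Cons.IH[OF mem(1)] closed P by (simp add: vs_neg_eq_smult vs_smult_assoc)
  finally show ?case .
qed

lemma symmetric_move:
  assumes f: "symmetric V r P f" and u: "a @ b @ x # c \<in> tuples V r"
  shows "f (a @ b @ x # c) = f (a @ x # b @ c)"
  using u
proof (induction b arbitrary: a)
  case (Cons y b)
  have mem: "a @ y # x # b @ c \<in> tuples V r"
    using Cons.prems by (auto simp: tuples_def)
  have "f (a @ (y # b) @ x # c) = f (a @ y # x # b @ c)"
    using Cons.IH[of "a @ [y]"] Cons.prems by simp
  also have "\<dots> = f (a @ x # y # b @ c)"
    using symmetric_swap[OF f mem, of "length a" "Suc (length a)"]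
    by (simp add: nth_append list_update_append)
  finally show ?case by simp
qed simp

text \<open>
  Move the entries of one tuple one by one, by adjacent swaps, to where the other tuple has them.
\<close>

lemma symmetric_mset:
  assumes f: "symmetric V r P f" and "w \<in> tuples V r" and "mset w = mset w'"
  shows "f w = f w'"
proof -
  have "f (a @ w) = f (a @ w')" if "a @ w \<in> tuples V r" "mset w = mset w'" for a w'
    using that
  proof (induction w arbitrary: a w')
    case (Cons x w)
    then have "x \<in> set w'" by (metis list.set_intros(1) set_mset_mset)
    then obtain b c where w': "w' = b @ x # c" by (auto dest: split_list)
    have mem: "a @ b @ x # c \<in> tuples V r"
      using Cons.prems mset_eq_length[OF Cons.prems(2)] mset_eq_setD[OF Cons.prems(2)] w'
      by (auto simp: tuples_def)
    have "f ((a @ [x]) @ w) = f ((a @ [x]) @ b @ c)"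
      using Cons.prems w' by (intro Cons.IH) auto
    then show ?case
      using symmetric_move[OF f mem] w' by simp
  qed simp
  from this[of "[]" w'] show ?thesis using assms(2,3) by simp
qed

text \<open>
  The sign in the exterior comultiplication is that of moving the omitted vector to the right end, so
  it cancels when this vector is multiplied back there.
\<close>

lemma alternating_omit_append:
  assumes f: "alternating V r P f" and V: "vspace V" and P: "vspace P"
    and u: "u \<in> tuples V r" and t: "t < length u"
  shows "(- 1) ^ (length u - Suc t) \<odot>\<^bsub>P\<^esub> f (omit t u @ [u ! t]) = f u"
proof -
  let ?a = "take t u" and ?b = "drop (Suc t) u" and ?x = "u ! t"
  have split: "u = ?a @ ?x # ?b @ []" using id_take_nth_drop[OF t] by simp
  have mem: "?a @ ?b @ [?x] \<in> tuples V r"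
    using u t unfolding tuples_def by (auto dest: in_set_takeD in_set_dropD nth_mem)
  have "f u = (- 1) ^ length ?b \<odot>\<^bsub>P\<^esub> f (?a @ ?b @ [?x])"
    using alternating_move[OF f V P, of ?a ?x ?b "[]"] u split by metis
  moreover have "f (?a @ ?b @ [?x]) \<in> carrier P"
    using f mem by (auto simp: alternating_def intro: multilin_closed)
  ultimately show ?thesis
    using P by (simp add: vs_smult_assoc omit_def flip: power_add mult_2)
qed

text \<open>
  If \<open>u ! s = u ! t\<close>, then only the terms omitting the positions \<open>s\<close> and \<open>t\<close> can be nonzero. They
  agree up to the sign of moving the common entry from one place to the other, and cancel.
\<close>

lemma alternating_comult:
  assumes V: "vspace V" and P: "vspace P"
    and f: "alternating V (r - 1) M f" and \<beta>: "bilin M V P \<beta>"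
  shows "alternating V r P (\<lambda>u. \<Oplus>\<^bsub>P\<^esub>t\<in>{..<length u}.
    (- 1) ^ (length u - Suc t) \<odot>\<^bsub>P\<^esub> \<beta> (f (omit t u)) (u ! t))"
proof -
  interpret P: abelian_group P by (rule vs_abelian_group[OF P])
  have f': "multilin V (r - 1) M f" using f by (simp add: alternating_def)
  let ?F = "\<lambda>u q. (- 1) ^ (length u - Suc q) \<odot>\<^bsub>P\<^esub> \<beta> (f (omit q u)) (u ! q)"
  have "multilin V r P (\<lambda>u. ?F u q)" if q: "int q < r" for q
    by (rule multilin_cong[OF multilin_smult[OF multilin_omit[OF f' \<beta> q] P,
            of "(- 1) ^ (nat r - Suc q)"]]) (auto simp: tuples_def)
  then have "multilin V r P (\<lambda>u. \<Oplus>\<^bsub>P\<^esub>q\<in>{..<length u}. ?F u q)"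
    by (rule multilin_finsum[OF V P])
  moreover have "(\<Oplus>\<^bsub>P\<^esub>q\<in>{..<length u}. ?F u q) = \<zero>\<^bsub>P\<^esub>"
    if u: "u \<in> tuples V r" and st: "s < t" "t < length u" "u ! s = u ! t" for u s t
  proof -
    have M: "vspace M"
      using lin_domain[OF bilin_left[OF \<beta> vs_zero_closed[OF V]]] .
    have omit: "f (omit q u) \<in> carrier M" if "q < length u" for q
      using u that by (intro multilin_closed[OF f'] omit_tuples)
    have F_closed: "?F u q \<in> carrier P" if "q < length u" for q
      using that u by (intro vs_smult_closed[OF P] bilin_closed[OF \<beta>] omit tuples_nth)
    have "?F u q = \<zero>\<^bsub>P\<^esub>" if q: "q < length u" "q \<noteq> s" "q \<noteq> t" for q
    proof -
      have "f (omit q u) = \<zero>\<^bsub>M\<^esub>"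
      proof (rule alternating_zero[OF f omit_tuples[OF u q(1)]])
        let ?shift = "\<lambda>k. if k < q then k else k - 1"
        show "?shift s < ?shift t" "?shift t < length (omit q u)"
          using q st by auto
        show "omit q u ! ?shift s = omit q u ! ?shift t"
          using q st by (auto simp: nth_omit)
      qed
      then show ?thesis
        using lin_zero[OF bilin_left[OF \<beta> tuples_nth[OF u q(1)]]] P by simp
    qed
    then have "(\<Oplus>\<^bsub>P\<^esub>q\<in>{..<length u}. ?F u q) = (\<Oplus>\<^bsub>P\<^esub>q\<in>{s, t}. ?F u q)"
      using st F_closed
      by (intro P.add.finprod_mono_neutral_cong_left[symmetric]) (auto simp: Pi_iff)
    also have "\<dots> = ?F u s \<oplus>\<^bsub>P\<^esub> ?F u t"
      using st F_closed[of s] F_closed[of t] by simp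
    also have "\<dots> = \<zero>\<^bsub>P\<^esub>"
    proof -
      \<comment> \<open>\<open>u = a x b x c\<close>, with the two equal entries at the positions \<open>s\<close> and \<open>t\<close>\<close>
      define a b c x where "a = take s u" and "b = take (t - Suc s) (drop (Suc s) u)"
        and "c = drop (Suc t) u" and "x = u ! s"
      have len: "length a = s" "length b = t - Suc s" "length c = length u - Suc t"
        using st by (auto simp: a_def b_def c_def)
      have "drop (Suc s) u = b @ drop (t - Suc s) (drop (Suc s) u)"
        by (simp only: b_def append_take_drop_id)
      also have "drop (t - Suc s) (drop (Suc s) u) = drop t u"
        using st by simp
      also have "\<dots> = x # c"
        using st by (simp add: x_def c_def Cons_nth_drop_Suc)
      finally have ux: "u = a @ x # b @ x # c"
        using id_take_nth_drop[of s u] st by (simp add: a_def x_def)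
      have os: "omit s u = a @ b @ x # c"
        using omit_append[of a x "b @ x # c"] ux len by simp
      have ot: "omit t u = a @ x # b @ c"
        using omit_append[of "a @ x # b" x c] ux len st by simp
      have mem: "a @ x # b @ c \<in> tuples V (r - 1)"
        using omit_tuples[OF u st(2)] by (simp add: ot)
      define y where "y = \<beta> (f (omit s u)) x"
      have y: "y \<in> carrier P"
        unfolding y_def x_def using u st by (intro bilin_closed[OF \<beta>] omit tuples_nth) auto
      have "f (omit t u) = (- 1) ^ length b \<odot>\<^bsub>M\<^esub> f (omit s u)"
        unfolding os ot by (rule alternating_move[OF f V M mem])
      then have "\<beta> (f (omit t u)) x = (- 1) ^ length b \<odot>\<^bsub>P\<^esub> y"
        using u st lin_smult[OF bilin_left[OF \<beta>] omit, of x s]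
        by (simp add: y_def x_def tuples_nth)
      then have "?F u s \<oplus>\<^bsub>P\<^esub> ?F u t = (- 1) ^ (length u - Suc s) \<odot>\<^bsub>P\<^esub> y
          \<oplus>\<^bsub>P\<^esub> ((- 1) ^ (length c) * (- 1) ^ length b) \<odot>\<^bsub>P\<^esub> y"
        using y P st by (simp add: y_def x_def vs_smult_assoc len)
      moreover have "length u - Suc s = Suc (length c + length b)"
        using len st by simp
      ultimately have "?F u s \<oplus>\<^bsub>P\<^esub> ?F u t = (- 1) ^ Suc (length c + length b) \<odot>\<^bsub>P\<^esub> y
          \<oplus>\<^bsub>P\<^esub> ((- 1) ^ (length c) * (- 1) ^ length b) \<odot>\<^bsub>P\<^esub> y"
        by simp
      also have "\<dots> = \<zero>\<^bsub>P\<^esub>"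
        using y P by (simp add: power_add flip: vs_smult_add_left)
      finally show ?thesis .
    qed
    finally show ?thesis .
  qed
  ultimately show ?thesis
    unfolding alternating_def by blast
qed

text \<open>
  Exchanging two entries of \<open>w\<close> only permutes the summands: corresponding summands single out the same
  vector, and the remaining vectors agree up to order.
\<close>

lemma symmetric_comult:
  assumes V: "vspace V" and P: "vspace P"
    and f: "symmetric V (r - 1) M f" and \<beta>: "bilin V M P \<beta>"
  shows "symmetric V r P (\<lambda>w. \<Oplus>\<^bsub>P\<^esub>t\<in>{..<length w}. \<beta> (w ! t) (f (omit t w)))"
proof -
  interpret P: abelian_group P by (rule vs_abelian_group[OF P])
  have f': "multilin V (r - 1) M f" using f by (simp add: symmetric_def)
  let ?F = "\<lambda>w q. \<beta> (w ! q) (f (omit q w))"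
  have F_closed: "?F w q \<in> carrier P" if "w \<in> tuples V r" "q < length w" for w q
    using that by (intro bilin_closed[OF \<beta>] multilin_closed[OF f'] omit_tuples tuples_nth)
  have "multilin V r P (\<lambda>w. \<Oplus>\<^bsub>P\<^esub>q\<in>{..<length w}. ?F w q)"
    using multilin_omit[OF f' bilin_swap[OF \<beta>]] by (rule multilin_finsum[OF V P])
  moreover have "(\<Oplus>\<^bsub>P\<^esub>q\<in>{..<length w}. ?F w q) = (\<Oplus>\<^bsub>P\<^esub>q\<in>{..<length w'}. ?F w' q)"
    if w: "w \<in> tuples V r" and st: "s < t" "t < length w" and w': "w' = w[s := w ! t, t := w ! s]"
    for w w' s t
  proof -
    \<comment> \<open>the transposition of \<open>s\<close> and \<open>t\<close>, which reindexes the sum\<close>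
    define h where "h q = (if q = s then t else if q = t then s else q)" for q
    have len: "length w' = length w" by (simp add: w')
    have w'_mem: "w' \<in> tuples V r" using w st by (simp add: w' tuples_update tuples_nth)
    have hh: "h (h q) = q" for q by (simp add: h_def)
    have h_less: "h q < length w \<longleftrightarrow> q < length w" for q using st by (auto simp: h_def)
    have inj: "inj_on h {..<length w}" by (metis hh inj_onI)
    have image: "h ` {..<length w} = {..<length w}"
    proof (intro equalityI subsetI)
      show "q \<in> h ` {..<length w}" if "q \<in> {..<length w}" for q
        using that h_less[of "h q"] hh[of q] by (metis image_eqI lessThan_iff)
    qed (auto simp: h_less)
    have nth: "w' ! h q = w ! q" if "q < length w" for q
      using that st by (auto simp: w' h_def nth_list_update)
    have term_eq: "?F w' (h q) = ?F w q" if q: "q < length w" for q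
    proof -
      have "mset w' = mset w" using st by (simp add: w' mset_swap)
      then have "mset (omit q w) = mset (omit (h q) w')"
        using q by (simp add: mset_omit h_less len nth)
      then have "f (omit q w) = f (omit (h q) w')"
        by (rule symmetric_mset[OF f omit_tuples[OF w q]])
      then show ?thesis using q by (simp add: nth)
    qed
    have "(\<Oplus>\<^bsub>P\<^esub>q\<in>{..<length w'}. ?F w' q) = (\<Oplus>\<^bsub>P\<^esub>q\<in>h ` {..<length w}. ?F w' q)"
      by (simp only: image len)
    also have "\<dots> = (\<Oplus>\<^bsub>P\<^esub>q\<in>{..<length w}. ?F w' (h q))"
      using F_closed[OF w'_mem] len by (intro P.finsum_reindex inj) (simp add: image Pi_iff)
    also have "\<dots> = (\<Oplus>\<^bsub>P\<^esub>q\<in>{..<length w}. ?F w q)"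
      using F_closed[OF w] by (intro P.finsum_cong') (simp_all add: term_eq Pi_iff)
    finally show ?thesis by simp
  qed
  ultimately show ?thesis
    unfolding symmetric_def by blast
qed

section \<open>Exterior and symmetric powers\<close>

lemma satisfies_Un: "satisfies X (R \<union> S) P f \<longleftrightarrow> satisfies X R P f \<and> satisfies X S P f"
  by (auto simp: satisfies_def)

lemma multilinear_relations_subset:
  "vspace V \<Longrightarrow> multilinear_relations V r \<subseteq> carrier (free_module (tuples V r))"
  unfolding multilinear_relations_def
  by (auto intro!: diff_in_free_module single_in_free_module tuples_update)

lemma exterior_relations_subset:
  "vspace V \<Longrightarrow> exterior_relations V r \<subseteq> carrier (free_module (tuples V r))"
  unfolding exterior_relations_def
  using multilinear_relations_subset[of V r] by (auto intro!: single_in_free_module)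

lemma symmetric_relations_subset:
  "vspace V \<Longrightarrow> symmetric_relations V r \<subseteq> carrier (free_module (tuples V r))"
  unfolding symmetric_relations_def
  using multilinear_relations_subset[of V r]
  by (auto intro!: diff_in_free_module single_in_free_module tuples_update tuples_nth)

lemma satisfies_multilinear_iff:
  assumes V: "vspace V" and P: "vspace P"
  shows "satisfies (tuples V r) (multilinear_relations V r) P f \<longleftrightarrow> multilin V r P f"
proof (cases "f \<in> tuples V r \<rightarrow> carrier P")
  case True
  note iffs = free_lift_zero_iffs[OF P True]
  have 1: "free_lift P f (Poly_Mapping.single (u[t := x \<oplus>\<^bsub>V\<^esub> y]) 1 - Poly_Mapping.single (u[t := x]) 1
      - Poly_Mapping.single (u[t := y]) 1) = \<zero>\<^bsub>P\<^esub>
      \<longleftrightarrow> f (u[t := x \<oplus>\<^bsub>V\<^esub> y]) = f (u[t := x]) \<oplus>\<^bsub>P\<^esub> f (u[t := y])"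
    if "u \<in> tuples V r" "x \<in> carrier V" "y \<in> carrier V" for u t x y
    using that V by (intro iffs tuples_update) auto
  have 2: "free_lift P f (Poly_Mapping.single (u[t := c \<odot>\<^bsub>V\<^esub> x]) 1 - Poly_Mapping.single (u[t := x]) c)
      = \<zero>\<^bsub>P\<^esub> \<longleftrightarrow> f (u[t := c \<odot>\<^bsub>V\<^esub> x]) = c \<odot>\<^bsub>P\<^esub> f (u[t := x])"
    if "u \<in> tuples V r" "x \<in> carrier V" for u t c x
    using that V by (intro iffs tuples_update) auto
  have "satisfies (tuples V r) (multilinear_relations V r) P f \<longleftrightarrow>
      (\<forall>u t x y. u \<in> tuples V r \<and> t < length u \<and> x \<in> carrier V \<and> y \<in> carrier V \<longrightarrow>
        f (u[t := x \<oplus>\<^bsub>V\<^esub> y]) = f (u[t := x]) \<oplus>\<^bsub>P\<^esub> f (u[t := y])) \<and>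
      (\<forall>u t c x. u \<in> tuples V r \<and> t < length u \<and> x \<in> carrier V \<longrightarrow>
        f (u[t := c \<odot>\<^bsub>V\<^esub> x]) = c \<odot>\<^bsub>P\<^esub> f (u[t := x]))"
    unfolding satisfies_def multilinear_relations_def ball_Un ball_setcompr4_iff
    using True by (simp add: 1 2 cong: conj_cong)
  also have "\<dots> \<longleftrightarrow> multilin V r P f" (is "?L \<longleftrightarrow> ?R")
  proof
    assume L: ?L
    have "lin V P (\<lambda>x. f (u[t := x]))" if "u \<in> tuples V r" "t < length u" for u t
      using L that True V P by (intro lin_intro) (auto simp: Pi_iff tuples_update)
    then show ?R using True by (simp add: multilin_def)
  next
    assume R: ?R
    show ?L
      using lin_add[OF multilin_lin[OF R]] lin_smult[OF multilin_lin[OF R]] by simp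
  qed
  finally show ?thesis .
qed (auto simp: satisfies_def multilin_def)

lemma satisfies_exterior_iff:
  assumes V: "vspace V" and P: "vspace P"
  shows "satisfies (tuples V r) (exterior_relations V r) P f \<longleftrightarrow> alternating V r P f"
proof (cases "multilin V r P f")
  case True
  then have f: "f \<in> tuples V r \<rightarrow> carrier P" by (simp add: multilin_def)
  have 1: "free_lift P f (Poly_Mapping.single u 1) = \<zero>\<^bsub>P\<^esub> \<longleftrightarrow> f u = \<zero>\<^bsub>P\<^esub>" if "u \<in> tuples V r" for u
    using free_lift_zero_iffs(1)[OF P f that that that] .
  show ?thesis
    unfolding exterior_relations_def satisfies_Un satisfies_multilinear_iff[OF V P] alternating_def
    unfolding satisfies_def ball_setcompr3_iff Ball_def[of "tuples V r"]
    using True f by (simp add: 1 imp_conjL cong: conj_cong)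
qed (simp add: exterior_relations_def satisfies_Un satisfies_multilinear_iff[OF V P] alternating_def)

lemma satisfies_symmetric_iff:
  assumes V: "vspace V" and P: "vspace P"
  shows "satisfies (tuples V r) (symmetric_relations V r) P f \<longleftrightarrow> symmetric V r P f"
proof (cases "multilin V r P f")
  case True
  then have f: "f \<in> tuples V r \<rightarrow> carrier P" by (simp add: multilin_def)
  have 1: "free_lift P f (Poly_Mapping.single w 1 - Poly_Mapping.single (w[s := w ! t, t := w ! s]) 1)
      = \<zero>\<^bsub>P\<^esub> \<longleftrightarrow> f w = f (w[s := w ! t, t := w ! s])"
    if "w \<in> tuples V r" "s < t" "t < length w" for w s t
  proof -
    have "w[s := w ! t, t := w ! s] \<in> tuples V r"
      using that by (simp add: tuples_update tuples_nth)
    then show ?thesis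
      using free_lift_zero_iffs(2)[OF P f that(1) _ that(1), of "w[s := w ! t, t := w ! s]" 1] f P
      by (auto simp: Pi_iff)
  qed
  show ?thesis
    unfolding symmetric_relations_def satisfies_Un satisfies_multilinear_iff[OF V P] symmetric_def
    unfolding satisfies_def ball_setcompr3_iff Ball_def[of "tuples V r"]
    using True f by (simp add: 1 imp_conjL cong: conj_cong)
qed (simp add: symmetric_relations_def satisfies_Un satisfies_multilinear_iff[OF V P] symmetric_def)

lemma vs_ext_power: "vspace V \<Longrightarrow> vspace (ext_power V r)"
  unfolding ext_power_def by (intro vs_presented_module exterior_relations_subset)

lemma vs_sym_power: "vspace V \<Longrightarrow> vspace (sym_power V j)"
  unfolding sym_power_def by (intro vs_presented_module symmetric_relations_subset)

lemma vs_ext_sym: "vspace V \<Longrightarrow> vspace (ext_sym V r j)"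
  by (intro vs_tensor vs_ext_power vs_sym_power)

lemma wedge_eq_generator:
  "u \<in> tuples V r \<Longrightarrow> wedge V u = generator (tuples V r) (exterior_relations V r) u"
  by (simp add: wedge_def tuples_def)

lemma sym_prod_eq_generator:
  "w \<in> tuples V j \<Longrightarrow> sym_prod V w = generator (tuples V j) (symmetric_relations V j) w"
  by (simp add: sym_prod_def tuples_def)

lemma alternating_wedge:
  assumes V: "vspace V"
  shows "alternating V r (ext_power V r) (wedge V)"
proof (rule alternating_cong[OF _ wedge_eq_generator])
  show "alternating V r (ext_power V r) (generator (tuples V r) (exterior_relations V r))"
    using satisfies_generator[OF exterior_relations_subset[OF V], of r]
    by (simp add: satisfies_exterior_iff[OF V vs_ext_power[OF V]] flip: ext_power_def)
qed

lemma symmetric_sym_prod: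
  assumes V: "vspace V"
  shows "symmetric V j (sym_power V j) (sym_prod V)"
proof (rule symmetric_cong[OF _ sym_prod_eq_generator])
  show "symmetric V j (sym_power V j) (generator (tuples V j) (symmetric_relations V j))"
    using satisfies_generator[OF symmetric_relations_subset[OF V], of j]
    by (simp add: satisfies_symmetric_iff[OF V vs_sym_power[OF V]] flip: sym_power_def)
qed

lemma multilin_wedge: "vspace V \<Longrightarrow> multilin V r (ext_power V r) (wedge V)"
  using alternating_wedge[of V r] by (simp add: alternating_def)

lemma multilin_sym_prod: "vspace V \<Longrightarrow> multilin V j (sym_power V j) (sym_prod V)"
  using symmetric_sym_prod[of V j] by (simp add: symmetric_def)

lemma wedge_closed: "vspace V \<Longrightarrow> u \<in> tuples V r \<Longrightarrow> wedge V u \<in> carrier (ext_power V r)"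
  by (rule multilin_closed[OF multilin_wedge])

lemma sym_prod_closed: "vspace V \<Longrightarrow> w \<in> tuples V j \<Longrightarrow> sym_prod V w \<in> carrier (sym_power V j)"
  by (rule multilin_closed[OF multilin_sym_prod])

lemma lin_ext_lift:
  assumes "vspace V" "vspace P" "alternating V r P f"
  shows "lin (ext_power V r) P (presented_lift P f)"
  unfolding ext_power_def
  by (rule lin_presented_lift) (simp_all add: assms exterior_relations_subset satisfies_exterior_iff)

lemma ext_lift_wedge:
  assumes "vspace V" "vspace P" "alternating V r P f" "u \<in> tuples V r"
  shows "presented_lift P f (wedge V u) = f u"
  unfolding wedge_eq_generator[OF assms(4)]
  by (rule presented_lift_generator) (simp_all add: assms exterior_relations_subset satisfies_exterior_iff)

lemma lin_sym_lift:
  assumes "vspace V" "vspace P" "symmetric V j P f"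
  shows "lin (sym_power V j) P (presented_lift P f)"
  unfolding sym_power_def
  by (rule lin_presented_lift) (simp_all add: assms symmetric_relations_subset satisfies_symmetric_iff)

lemma sym_lift_sym_prod:
  assumes "vspace V" "vspace P" "symmetric V j P f" "w \<in> tuples V j"
  shows "presented_lift P f (sym_prod V w) = f w"
  unfolding sym_prod_eq_generator[OF assms(4)]
  by (rule presented_lift_generator) (simp_all add: assms symmetric_relations_subset satisfies_symmetric_iff)

lemma bilin_ext_powerI:
  assumes V: "vspace V" and N: "vspace N" and P: "vspace P"
    and left: "\<And>y. y \<in> carrier N \<Longrightarrow> lin (ext_power V r) P (\<lambda>x. \<beta> x y)"
    and right: "\<And>u. u \<in> tuples V r \<Longrightarrow> lin N P (\<beta> (wedge V u))"
  shows "bilin (ext_power V r) N P \<beta>"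
  using left right unfolding ext_power_def
  by (intro bilin_presentedI exterior_relations_subset V N P) (simp_all add: wedge_eq_generator)

lemma bilin_sym_powerI:
  assumes V: "vspace V" and N: "vspace N" and P: "vspace P"
    and left: "\<And>y. y \<in> carrier N \<Longrightarrow> lin (sym_power V j) P (\<lambda>x. \<beta> x y)"
    and right: "\<And>w. w \<in> tuples V j \<Longrightarrow> lin N P (\<beta> (sym_prod V w))"
  shows "bilin (sym_power V j) N P \<beta>"
  using left right unfolding sym_power_def
  by (intro bilin_presentedI symmetric_relations_subset V N P) (simp_all add: sym_prod_eq_generator)

abbreviation ext_sym_monomial where
  "ext_sym_monomial V r j u w \<equiv>
     pure_tensor (ext_power V r) (sym_power V j) (wedge V u) (sym_prod V w)"

lemma bilin_ext_sym:
  "vspace V \<Longrightarrow> bilin (ext_power V r) (sym_power V j) (ext_sym V r j)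
    (pure_tensor (ext_power V r) (sym_power V j))"
  by (intro bilin_pure_tensor vs_ext_power vs_sym_power)

lemma ext_sym_monomial_closed:
  "vspace V \<Longrightarrow> u \<in> tuples V r \<Longrightarrow> w \<in> tuples V j \<Longrightarrow>
   ext_sym_monomial V r j u w \<in> carrier (ext_sym V r j)"
  by (intro bilin_closed[OF bilin_ext_sym] wedge_closed sym_prod_closed)

text \<open>
  The monomials span: first extend from products of vectors to all of the symmetric power, and then
  from wedges to all of the exterior power.
\<close>

lemma lin_ext_sym_eq:
  assumes V: "vspace V" and g: "lin (ext_sym V r j) P g" and h: "lin (ext_sym V r j) P h"
    and eq: "\<And>u w. \<lbrakk>u \<in> tuples V r; w \<in> tuples V j\<rbrakk> \<Longrightarrow>
      g (ext_sym_monomial V r j u w) = h (ext_sym_monomial V r j u w)"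
    and z: "z \<in> carrier (ext_sym V r j)"
  shows "g z = h z"
proof (rule lin_tensor_eq[OF vs_ext_power[OF V] vs_sym_power[OF V] g h _ z])
  let ?t = "pure_tensor (ext_power V r) (sym_power V j)"
  fix x y assume x: "x \<in> carrier (ext_power V r)" and y: "y \<in> carrier (sym_power V j)"
  have wedge: "g (?t (wedge V u) y) = h (?t (wedge V u) y)" if u: "u \<in> tuples V r" for u
  proof -
    note right = bilin_right[OF bilin_ext_sym[OF V, of r j] wedge_closed[OF V u]]
    show ?thesis
      by (rule lin_presented_eq[OF symmetric_relations_subset[OF V]
            lin_comp[OF right g, unfolded sym_power_def[of V j]]
            lin_comp[OF right h, unfolded sym_power_def[of V j]]
            _ y[unfolded sym_power_def], folded sym_power_def])
        (simp add: eq[OF u] flip: sym_prod_eq_generator)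
  qed
  note left = bilin_left[OF bilin_ext_sym[OF V, of r j] y]
  show "g (?t x y) = h (?t x y)"
    by (rule lin_presented_eq[OF exterior_relations_subset[OF V]
          lin_comp[OF left g, unfolded ext_power_def[of V r]]
          lin_comp[OF left h, unfolded ext_power_def[of V r]]
          _ x[unfolded ext_power_def], folded ext_power_def])
      (simp add: wedge flip: wedge_eq_generator)
qed

section \<open>Multiplications and comultiplications\<close>

context
  fixes V :: "('k::field, 'v) module"
  assumes V: "vspace V"
begin

text \<open>
  For fixed \<open>v\<close> the product with \<open>v\<close> is a lift from the exterior power. Linearity in \<open>v\<close> is visible on
  wedges, and this suffices because wedges generate.
\<close>

lemma bilin_ext_mult: "bilin (ext_power V r) V (ext_power V (r + 1)) (ext_mult V r)"
  and ext_mult_wedge: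
    "u \<in> tuples V r \<Longrightarrow> v \<in> carrier V \<Longrightarrow> ext_mult V r (wedge V u) v = wedge V (u @ [v])"
proof -
  let ?P = "ext_power V (r + 1)"
  have alt: "alternating V r ?P (\<lambda>u. wedge V (u @ [v]))" if v: "v \<in> carrier V" for v
    unfolding alternating_def
  proof (intro conjI ballI allI impI)
    show "multilin V r ?P (\<lambda>u. wedge V (u @ [v]))"
      by (rule multilin_append[OF multilin_wedge[OF V] v])
    fix u s t assume u: "u \<in> tuples V r" "s < t" "t < length u" "u ! s = u ! t"
    then have "u @ [v] \<in> tuples V (r + 1)" using v by (simp add: tuples_def)
    then show "wedge V (u @ [v]) = \<zero>\<^bsub>?P\<^esub>"
      using u alternating_zero[OF alternating_wedge[OF V, of "r + 1"], of "u @ [v]" s t]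
      by (simp add: nth_append)
  qed
  have wedge: "ext_mult V r (wedge V u) v = wedge V (u @ [v])"
    if "u \<in> tuples V r" "v \<in> carrier V" for u v
    unfolding ext_mult_def
    by (rule ext_lift_wedge[OF V vs_ext_power[OF V] alt[OF that(2)] that(1)])
  then show "u \<in> tuples V r \<Longrightarrow> v \<in> carrier V \<Longrightarrow> ext_mult V r (wedge V u) v = wedge V (u @ [v])" .
  show "bilin (ext_power V r) V ?P (ext_mult V r)"
  proof (rule bilin_ext_powerI[OF V V vs_ext_power[OF V]])
    show "lin (ext_power V r) ?P (\<lambda>x. ext_mult V r x v)" if "v \<in> carrier V" for v
      unfolding ext_mult_def by (intro lin_ext_lift V vs_ext_power alt that)
    show "lin V ?P (ext_mult V r (wedge V u))" if u: "u \<in> tuples V r" for u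
      by (rule lin_cong[OF multilin_append_last[OF multilin_wedge[OF V] u V] wedge[OF u]])
  qed
qed

lemma bilin_sym_mult: "bilin V (sym_power V j) (sym_power V (j + 1)) (sym_mult V j)"
  and sym_mult_sym_prod:
    "w \<in> tuples V j \<Longrightarrow> v \<in> carrier V \<Longrightarrow> sym_mult V j v (sym_prod V w) = sym_prod V (v # w)"
proof -
  let ?P = "sym_power V (j + 1)"
  have sym: "symmetric V j ?P (\<lambda>w. sym_prod V (v # w))" if v: "v \<in> carrier V" for v
    unfolding symmetric_def
  proof (intro conjI ballI allI impI)
    show "multilin V j ?P (\<lambda>w. sym_prod V (v # w))"
      by (rule multilin_Cons[OF multilin_sym_prod[OF V] v])
    fix w s t assume w: "w \<in> tuples V j" "s < t" "t < length w"
    then have "v # w \<in> tuples V (j + 1)" using v by (simp add: tuples_def)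
    then show "sym_prod V (v # w) = sym_prod V (v # w[s := w ! t, t := w ! s])"
      using w symmetric_swap[OF symmetric_sym_prod[OF V, of "j + 1"], of "v # w" "Suc s" "Suc t"]
      by simp
  qed
  have prod: "sym_mult V j v (sym_prod V w) = sym_prod V (v # w)"
    if "w \<in> tuples V j" "v \<in> carrier V" for w v
    unfolding sym_mult_def
    by (rule sym_lift_sym_prod[OF V vs_sym_power[OF V] sym[OF that(2)] that(1)])
  then show "w \<in> tuples V j \<Longrightarrow> v \<in> carrier V \<Longrightarrow> sym_mult V j v (sym_prod V w) = sym_prod V (v # w)" .
  have "bilin (sym_power V j) V ?P (\<lambda>s v. sym_mult V j v s)"
  proof (rule bilin_sym_powerI[OF V V vs_sym_power[OF V]])
    show "lin (sym_power V j) ?P (\<lambda>s. sym_mult V j v s)" if "v \<in> carrier V" for v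
      unfolding sym_mult_def by (intro lin_sym_lift V vs_sym_power sym that)
    show "lin V ?P (\<lambda>v. sym_mult V j v (sym_prod V w))" if w: "w \<in> tuples V j" for w
      by (rule lin_cong[OF multilin_Cons_head[OF multilin_sym_prod[OF V] w V] prod[OF w]])
  qed
  then show "bilin V (sym_power V j) ?P (sym_mult V j)" by (rule bilin_swap)
qed

lemma lin_ext_comult: "lin (ext_power V r) (tensor (ext_power V (r - 1)) V) (ext_comult V r)"
  and ext_comult_wedge: "u \<in> tuples V r \<Longrightarrow>
    ext_comult V r (wedge V u) = (\<Oplus>\<^bsub>tensor (ext_power V (r - 1)) V\<^esub>t\<in>{..<length u}.
      (- 1) ^ (length u - Suc t) \<odot>\<^bsub>tensor (ext_power V (r - 1)) V\<^esub>
        pure_tensor (ext_power V (r - 1)) V (wedge V (omit t u)) (u ! t))"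
proof -
  note E = vs_ext_power[OF V, of "r - 1"]
  note alt = alternating_comult[OF V vs_tensor[OF E V] alternating_wedge[OF V] bilin_pure_tensor[OF E V]]
  show "lin (ext_power V r) (tensor (ext_power V (r - 1)) V) (ext_comult V r)"
    unfolding ext_comult_def Let_def by (intro lin_ext_lift V E vs_tensor alt)
  show "u \<in> tuples V r \<Longrightarrow>
    ext_comult V r (wedge V u) = (\<Oplus>\<^bsub>tensor (ext_power V (r - 1)) V\<^esub>t\<in>{..<length u}.
      (- 1) ^ (length u - Suc t) \<odot>\<^bsub>tensor (ext_power V (r - 1)) V\<^esub>
        pure_tensor (ext_power V (r - 1)) V (wedge V (omit t u)) (u ! t))"
    unfolding ext_comult_def Let_def by (rule ext_lift_wedge[OF V vs_tensor[OF E V] alt])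
qed

lemma lin_sym_comult: "lin (sym_power V j) (tensor V (sym_power V (j - 1))) (sym_comult V j)"
  and sym_comult_sym_prod: "w \<in> tuples V j \<Longrightarrow>
    sym_comult V j (sym_prod V w) = (\<Oplus>\<^bsub>tensor V (sym_power V (j - 1))\<^esub>t\<in>{..<length w}.
      pure_tensor V (sym_power V (j - 1)) (w ! t) (sym_prod V (omit t w)))"
proof -
  note S = vs_sym_power[OF V, of "j - 1"]
  note sym = symmetric_comult[OF V vs_tensor[OF V S] symmetric_sym_prod[OF V] bilin_pure_tensor[OF V S]]
  show "lin (sym_power V j) (tensor V (sym_power V (j - 1))) (sym_comult V j)"
    unfolding sym_comult_def Let_def by (intro lin_sym_lift V S vs_tensor sym)
  show "w \<in> tuples V j \<Longrightarrow>
    sym_comult V j (sym_prod V w) = (\<Oplus>\<^bsub>tensor V (sym_power V (j - 1))\<^esub>t\<in>{..<length w}.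
      pure_tensor V (sym_power V (j - 1)) (w ! t) (sym_prod V (omit t w)))"
    unfolding sym_comult_def Let_def by (rule sym_lift_sym_prod[OF V vs_tensor[OF V S] sym])
qed

end

section \<open>The Koszul map and \<open>\<phi>\<close> on monomials\<close>

context
  fixes V :: "('k::field, 'v) module"
  assumes V: "vspace V"
begin

lemma
  fixes a b :: int
  defines "E \<equiv> ext_power V (b - 1)" and "S \<equiv> sym_power V (a + 1)" and "P \<equiv> ext_sym V (b - 1) (a + 1)"
  shows lin_koszul: "lin (ext_sym V b a) P (koszul V a b)"
    and koszul_monomial: "\<lbrakk>u \<in> tuples V b; w \<in> tuples V a\<rbrakk> \<Longrightarrow>
      koszul V a b (ext_sym_monomial V b a u w) = (\<Oplus>\<^bsub>P\<^esub>t\<in>{..<length u}.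
        (- 1) ^ (length u - Suc t) \<odot>\<^bsub>P\<^esub> ext_sym_monomial V (b - 1) (a + 1) (omit t u) (u ! t # w))"
proof -
  have E: "vspace E" and P: "vspace P"
    unfolding E_def P_def by (intro vs_ext_power vs_ext_sym V)+
  note pure = bilin_ext_sym[OF V, of "b - 1" "a + 1", folded P_def, folded E_def S_def]
  note mult = bilin_sym_mult[OF V, of a, folded S_def]
  note \<Delta> = lin_ext_comult[OF V, of b, folded E_def]
  let ?\<gamma> = "\<lambda>y v s. pure_tensor E S y (sym_mult V a v s)"
  have bc: "bilin E V P (\<lambda>y v. ?\<gamma> y v s)" if s: "s \<in> carrier (sym_power V a)" for s
  proof (rule bilinI)
    show "lin V P (\<lambda>v. ?\<gamma> y v s)" if "y \<in> carrier E" for y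
      by (rule lin_comp[OF bilin_left[OF mult s] bilin_right[OF pure that]])
    show "lin E P (\<lambda>y. ?\<gamma> y v s)" if "v \<in> carrier V" for v
      by (rule bilin_left[OF pure bilin_closed[OF mult that s]])
  qed
  have d: "lin (sym_power V a) P (?\<gamma> y v)" if "y \<in> carrier E" "v \<in> carrier V" for y v
    by (rule lin_comp[OF bilin_right[OF mult that(2)] bilin_right[OF pure that(1)]])
  let ?\<beta> = "\<lambda>x s. tensor_lift P (\<lambda>y v. ?\<gamma> y v s) (ext_comult V b x)"
  have \<beta>: "bilin (ext_power V b) (sym_power V a) P ?\<beta>"
    by (rule bilin_comult_mult[OF E V vs_sym_power[OF V] \<Delta> bc d P])
  have koszul: "koszul V a b = tensor_lift P ?\<beta>"
    by (simp only: koszul_def E_def S_def P_def)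
  show "lin (ext_sym V b a) P (koszul V a b)"
    unfolding koszul by (rule lin_tensor_lift[OF vs_ext_power[OF V] vs_sym_power[OF V] P \<beta>])
  assume u: "u \<in> tuples V b" and w: "w \<in> tuples V a"
  let ?w = "sym_prod V w" and ?sgn = "\<lambda>t. (- 1) ^ (length u - Suc t)"
  let ?e = "\<lambda>t. pure_tensor E V (wedge V (omit t u)) (u ! t)"
  have w': "?w \<in> carrier (sym_power V a)" by (rule sym_prod_closed[OF V w])
  have omit: "wedge V (omit t u) \<in> carrier E" if "t < length u" for t
    unfolding E_def using u that by (intro wedge_closed V omit_tuples)
  have e: "?e t \<in> carrier (tensor E V)" if "t < length u" for t
    using that u by (intro bilin_closed[OF bilin_pure_tensor[OF E V]] omit tuples_nth)
  note lift = lin_tensor_lift[OF E V P bc[OF w']]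
  have term_eq: "tensor_lift P (\<lambda>y v. ?\<gamma> y v ?w) (?sgn t \<odot>\<^bsub>tensor E V\<^esub> ?e t)
      = ?sgn t \<odot>\<^bsub>P\<^esub> pure_tensor E S (wedge V (omit t u)) (sym_prod V (u ! t # w))"
    if t: "t < length u" for t
    unfolding lin_smult[OF lift e[OF t]] tensor_lift_pure[OF E V P bc[OF w'] omit[OF t] tuples_nth[OF u t]]
    by (simp only: sym_mult_sym_prod[OF V w tuples_nth[OF u t]])
  have "koszul V a b (ext_sym_monomial V b a u w) = ?\<beta> (wedge V u) ?w"
    unfolding koszul
    by (rule tensor_lift_pure[OF vs_ext_power[OF V] vs_sym_power[OF V] P \<beta> wedge_closed[OF V u] w'])
  also have "\<dots> = (\<Oplus>\<^bsub>P\<^esub>t\<in>{..<length u}.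
      tensor_lift P (\<lambda>y v. ?\<gamma> y v ?w) (?sgn t \<odot>\<^bsub>tensor E V\<^esub> ?e t))"
    unfolding ext_comult_wedge[OF V u, folded E_def]
    using e vs_tensor[OF E V] by (intro lin_finsum[OF lift]) auto
  also have "\<dots> = (\<Oplus>\<^bsub>P\<^esub>t\<in>{..<length u}. ?sgn t \<odot>\<^bsub>P\<^esub>
      pure_tensor E S (wedge V (omit t u)) (sym_prod V (u ! t # w)))"
  proof (rule abelian_monoid.finsum_cong'[OF _ refl _ term_eq])
    show "abelian_monoid P" using vs_abelian_group[OF P] by (rule abelian_group.axioms)
    have "u ! t # w \<in> tuples V (a + 1)" if "t < length u" for t
      using u w that by (auto simp: tuples_def)
    then show "(\<lambda>t. ?sgn t \<odot>\<^bsub>P\<^esub> pure_tensor E S (wedge V (omit t u)) (sym_prod V (u ! t # w)))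
        \<in> {..<length u} \<rightarrow> carrier P"
      using omit by (intro funcsetI vs_smult_closed P bilin_closed[OF pure])
        (auto simp: S_def intro!: sym_prod_closed V)
  qed simp
  finally show "koszul V a b (ext_sym_monomial V b a u w) = (\<Oplus>\<^bsub>P\<^esub>t\<in>{..<length u}.
      ?sgn t \<odot>\<^bsub>P\<^esub> ext_sym_monomial V (b - 1) (a + 1) (omit t u) (u ! t # w))"
    by (simp only: E_def S_def)
qed

lemma
  fixes r j :: int
  defines "E \<equiv> ext_power V (r + 1)" and "S \<equiv> sym_power V (j - 1)" and "P \<equiv> ext_sym V (r + 1) (j - 1)"
  shows lin_phi: "lin (ext_sym V r j) P (phi V r j)"
    and phi_monomial: "\<lbrakk>u \<in> tuples V r; w \<in> tuples V j\<rbrakk> \<Longrightarrow>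
      phi V r j (ext_sym_monomial V r j u w) = (\<Oplus>\<^bsub>P\<^esub>s\<in>{..<length w}.
        ext_sym_monomial V (r + 1) (j - 1) (u @ [w ! s]) (omit s w))"
proof -
  have S: "vspace S" and P: "vspace P"
    unfolding S_def P_def by (intro vs_sym_power vs_ext_sym V)+
  note pure = bilin_ext_sym[OF V, of "r + 1" "j - 1", folded P_def, folded E_def S_def]
  note mult = bilin_ext_mult[OF V, of r, folded E_def]
  note \<Delta> = lin_sym_comult[OF V, of j, folded S_def]
  let ?\<gamma> = "\<lambda>v s x. pure_tensor E S (ext_mult V r x v) s"
  have bc: "bilin V S P (\<lambda>v s. ?\<gamma> v s x)" if x: "x \<in> carrier (ext_power V r)" for x
  proof (rule bilinI)
    show "lin S P (\<lambda>s. ?\<gamma> v s x)" if "v \<in> carrier V" for v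
      by (rule bilin_right[OF pure bilin_closed[OF mult x that]])
    show "lin V P (\<lambda>v. ?\<gamma> v s x)" if "s \<in> carrier S" for s
      by (rule lin_comp[OF bilin_right[OF mult x] bilin_left[OF pure that]])
  qed
  have d: "lin (ext_power V r) P (?\<gamma> v s)" if "v \<in> carrier V" "s \<in> carrier S" for v s
    by (rule lin_comp[OF bilin_left[OF mult that(1)] bilin_left[OF pure that(2)]])
  let ?\<beta> = "\<lambda>x s. tensor_lift P (\<lambda>v s'. ?\<gamma> v s' x) (sym_comult V j s)"
  have \<beta>: "bilin (ext_power V r) (sym_power V j) P ?\<beta>"
    by (rule bilin_swap[OF bilin_comult_mult[OF V S vs_ext_power[OF V] \<Delta> bc d P]])
  have phi: "phi V r j = tensor_lift P ?\<beta>"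
    by (simp only: phi_def E_def S_def P_def)
  show "lin (ext_sym V r j) P (phi V r j)"
    unfolding phi by (rule lin_tensor_lift[OF vs_ext_power[OF V] vs_sym_power[OF V] P \<beta>])
  assume u: "u \<in> tuples V r" and w: "w \<in> tuples V j"
  let ?u = "wedge V u"
  let ?e = "\<lambda>s. pure_tensor V S (w ! s) (sym_prod V (omit s w))"
  have u': "?u \<in> carrier (ext_power V r)" by (rule wedge_closed[OF V u])
  have omit: "sym_prod V (omit s w) \<in> carrier S" if "s < length w" for s
    unfolding S_def using w that by (intro sym_prod_closed V omit_tuples)
  have e: "?e s \<in> carrier (tensor V S)" if "s < length w" for s
    using that w by (intro bilin_closed[OF bilin_pure_tensor[OF V S]] omit tuples_nth)
  note lift = lin_tensor_lift[OF V S P bc[OF u']]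
  have term_eq: "tensor_lift P (\<lambda>v s'. ?\<gamma> v s' ?u) (?e s)
      = pure_tensor E S (wedge V (u @ [w ! s])) (sym_prod V (omit s w))"
    if s: "s < length w" for s
    unfolding tensor_lift_pure[OF V S P bc[OF u'] tuples_nth[OF w s] omit[OF s]]
    by (simp only: ext_mult_wedge[OF V u tuples_nth[OF w s]])
  have "phi V r j (ext_sym_monomial V r j u w) = ?\<beta> ?u (sym_prod V w)"
    unfolding phi
    by (rule tensor_lift_pure[OF vs_ext_power[OF V] vs_sym_power[OF V] P \<beta> u' sym_prod_closed[OF V w]])
  also have "\<dots> = (\<Oplus>\<^bsub>P\<^esub>s\<in>{..<length w}. tensor_lift P (\<lambda>v s'. ?\<gamma> v s' ?u) (?e s))"
    unfolding sym_comult_sym_prod[OF V w, folded S_def]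
    using e by (intro lin_finsum[OF lift]) auto
  also have "\<dots> = (\<Oplus>\<^bsub>P\<^esub>s\<in>{..<length w}.
      pure_tensor E S (wedge V (u @ [w ! s])) (sym_prod V (omit s w)))"
  proof (rule abelian_monoid.finsum_cong'[OF _ refl _ term_eq])
    show "abelian_monoid P" using vs_abelian_group[OF P] by (rule abelian_group.axioms)
    have "u @ [w ! s] \<in> tuples V (r + 1)" if "s < length w" for s
      using u w that by (auto simp: tuples_def)
    then show "(\<lambda>s. pure_tensor E S (wedge V (u @ [w ! s])) (sym_prod V (omit s w)))
        \<in> {..<length w} \<rightarrow> carrier P"
      using omit by (intro funcsetI bilin_closed[OF pure])
        (auto simp: E_def intro!: wedge_closed V)
  qed simp
  finally show "phi V r j (ext_sym_monomial V r j u w) = (\<Oplus>\<^bsub>P\<^esub>s\<in>{..<length w}.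
      ext_sym_monomial V (r + 1) (j - 1) (u @ [w ! s]) (omit s w))"
    by (simp only: E_def S_def)
qed

end

section \<open>Rearranging finite sums\<close>

lemma (in abelian_monoid) finsum_lessThan_Suc:
  assumes "f \<in> {..<Suc n} \<rightarrow> carrier G"
  shows "(\<Oplus>i\<in>{..<Suc n}. f i) = (\<Oplus>i\<in>{..<n}. f i) \<oplus> f n"
proof -
  have "(\<Oplus>i\<in>insert n {..<n}. f i) = f n \<oplus> (\<Oplus>i\<in>{..<n}. f i)"
    using assms by (intro finsum_insert) (auto simp: Pi_iff)
  then show ?thesis
    using assms by (simp add: lessThan_Suc a_comm Pi_iff)
qed

lemma (in abelian_monoid) finsum_lessThan_Suc_shift:
  assumes "f \<in> {..<Suc n} \<rightarrow> carrier G"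
  shows "(\<Oplus>i\<in>{..<Suc n}. f i) = f 0 \<oplus> (\<Oplus>i\<in>{..<n}. f (Suc i))"
  using assms
proof (induction n)
  case (Suc n)
  then have f: "f i \<in> carrier G" if "i < Suc (Suc n)" for i using that by auto
  have "(\<Oplus>i\<in>{..<Suc (Suc n)}. f i) = (f 0 \<oplus> (\<Oplus>i\<in>{..<n}. f (Suc i))) \<oplus> f (Suc n)"
    using Suc f by (subst finsum_lessThan_Suc) auto
  also have "\<dots> = f 0 \<oplus> (\<Oplus>i\<in>{..<Suc n}. f (Suc i))"
    using f by (subst finsum_lessThan_Suc) (auto intro!: a_assoc)
  finally show ?case .
qed (simp add: lessThan_Suc)

lemma (in abelian_monoid) finsum_swap:
  assumes "finite A" and B: "finite B" and f: "\<And>i k. i \<in> A \<Longrightarrow> k \<in> B \<Longrightarrow> f i k \<in> carrier G"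
  shows "(\<Oplus>i\<in>A. \<Oplus>k\<in>B. f i k) = (\<Oplus>k\<in>B. \<Oplus>i\<in>A. f i k)"
  using assms(1) f
proof (induction A)
  case (insert a A)
  have "(\<Oplus>k\<in>B. \<Oplus>i\<in>insert a A. f i k) = (\<Oplus>k\<in>B. f a k \<oplus> (\<Oplus>i\<in>A. f i k))"
    using insert by (intro finsum_cong') (auto simp: Pi_iff)
  also have "\<dots> = (\<Oplus>k\<in>B. f a k) \<oplus> (\<Oplus>k\<in>B. \<Oplus>i\<in>A. f i k)"
    using insert by (intro finsum_addf) (auto simp: Pi_iff)
  finally show ?case
    using insert by (simp add: Pi_iff)
qed (simp add: finsum_zero)

lemma vs_finsum_const:
  assumes P: "vspace P" and x: "x \<in> carrier P"
  shows "(\<Oplus>\<^bsub>P\<^esub>i\<in>{..<n::nat}. x) = of_nat n \<odot>\<^bsub>P\<^esub> x"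
proof -
  interpret P: abelian_group P by (rule vs_abelian_group[OF P])
  show ?thesis
  proof (induction n)
    case (Suc n)
    then have "(\<Oplus>\<^bsub>P\<^esub>i\<in>{..<Suc n}. x) = of_nat n \<odot>\<^bsub>P\<^esub> x \<oplus>\<^bsub>P\<^esub> 1 \<odot>\<^bsub>P\<^esub> x"
      using x P P.finsum_lessThan_Suc[of "\<lambda>_. x" n] by simp
    then show ?case
      using x P by (simp only: vs_smult_add_left[symmetric] of_nat_Suc add.commute)
  qed (use x P in simp)
qed

section \<open>The homotopy identity\<close>

text \<open>
  On a monomial \<open>u \<otimes> w\<close> with \<open>u\<close> of length \<open>r\<close> and \<open>w\<close> of length \<open>j\<close>, both composites exchange a vector
  of \<open>u\<close> with a vector of \<open>w\<close>, or bring one vector back to where it came from. The exchange terms are the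
  same in both composites, but with opposite signs: \<open>\<phi>\<close> appends a vector on the right of the exterior
  part, so that a vector of \<open>u\<close> which \<open>\<kappa>\<close> takes out afterwards has one more place to pass. The return
  terms are all equal to \<open>u \<otimes> w\<close>: there are \<open>r\<close> of them if \<open>\<kappa>\<close> comes first, and \<open>j\<close> if \<open>\<phi>\<close> comes first.
\<close>

lemma koszul_phi_homotopy:
  fixes V :: "('k::field, 'v) module"
  assumes V: "vspace V" and z: "z \<in> carrier (ext_sym V r j)"
  shows "phi V (r - 1) (j + 1) (koszul V j r z) \<oplus>\<^bsub>ext_sym V r j\<^esub> koszul V (j - 1) (r + 1) (phi V r j z)
    = of_int (r + j) \<odot>\<^bsub>ext_sym V r j\<^esub> z"
proof -
  let ?P = "ext_sym V r j" and ?m = "ext_sym_monomial V r j"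
  let ?K = "ext_sym V (r - 1) (j + 1)" and ?F = "ext_sym V (r + 1) (j - 1)"
  have P: "vspace ?P" by (rule vs_ext_sym[OF V])
  interpret P: abelian_group ?P by (rule vs_abelian_group[OF P])
  note \<kappa> = lin_koszul[OF V, of r j] and \<phi> = lin_phi[OF V, of r j]
  have \<phi>': "lin ?K ?P (phi V (r - 1) (j + 1))" using lin_phi[OF V, of "r - 1" "j + 1"] by simp
  have \<kappa>': "lin ?F ?P (koszul V (j - 1) (r + 1))" using lin_koszul[OF V, of "r + 1" "j - 1"] by simp
  show ?thesis
  proof (rule lin_ext_sym_eq[OF V lin_pointwise_add[OF lin_comp[OF \<kappa> \<phi>'] lin_comp[OF \<phi> \<kappa>']]
        lin_pointwise_smult[OF lin_ident[OF P]] _ z])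
    fix u w assume u: "u \<in> tuples V r" and w: "w \<in> tuples V j"
    define x where "x = ?m u w"
    define sgn :: "nat \<Rightarrow> 'k" where "sgn t = (- 1) ^ (length u - Suc t)" for t
    \<comment> \<open>the term in which the entry \<open>t\<close> of \<open>u\<close> and the entry \<open>s\<close> of \<open>w\<close> have changed sides\<close>
    define A where "A t s = sgn t \<odot>\<^bsub>?P\<^esub> ?m (omit t u @ [w ! s]) (u ! t # omit s w)" for t s
    have x: "x \<in> carrier ?P" unfolding x_def by (rule ext_sym_monomial_closed[OF V u w])
    have m_closed: "?m (omit t u @ [w ! s]) (u ! t # omit s w) \<in> carrier ?P"
      if "t < length u" "s < length w" for t s
    proof (rule ext_sym_monomial_closed[OF V])
      show "omit t u @ [w ! s] \<in> tuples V r" "u ! t # omit s w \<in> tuples V j"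
        using omit_tuples[OF u that(1)] omit_tuples[OF w that(2)] tuples_nth[OF u that(1)]
          tuples_nth[OF w that(2)] by (simp_all add: tuples_def)
    qed
    have A: "A t s \<in> carrier ?P" if "t < length u" "s < length w" for t s
      unfolding A_def using that by (intro vs_smult_closed P m_closed)

    have phi_koszul: "phi V (r - 1) (j + 1) (koszul V j r x)
        = of_nat (length u) \<odot>\<^bsub>?P\<^esub> x \<oplus>\<^bsub>?P\<^esub> (\<Oplus>\<^bsub>?P\<^esub>t\<in>{..<length u}. \<Oplus>\<^bsub>?P\<^esub>s\<in>{..<length w}. A t s)"
    proof -
      have term_eq: "phi V (r - 1) (j + 1) (sgn t \<odot>\<^bsub>?K\<^esub> ext_sym_monomial V (r - 1) (j + 1) (omit t u) (u ! t # w))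
          = x \<oplus>\<^bsub>?P\<^esub> (\<Oplus>\<^bsub>?P\<^esub>s\<in>{..<length w}. A t s)" if t: "t < length u" for t
      proof -
        have o: "omit t u \<in> tuples V (r - 1)" by (rule omit_tuples[OF u t])
        have c: "u ! t # w \<in> tuples V (j + 1)" using tuples_nth[OF u t] w by (simp add: tuples_def)
        let ?f = "\<lambda>s. ?m (omit t u @ [(u ! t # w) ! s]) (omit s (u ! t # w))"
        have omit_Cons: "omit 0 (u ! t # w) = w" "omit (Suc s) (u ! t # w) = u ! t # omit s w" for s
          by (simp_all add: omit_def)
        \<comment> \<open>\<open>\<phi>\<close> takes the vector that \<open>\<kappa>\<close> has just put in front of \<open>w\<close>\<close>
        have last: "sgn t \<odot>\<^bsub>?P\<^esub> ?m (omit t u @ [u ! t]) w = x"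
        proof -
          have "omit t u @ [u ! t] \<in> tuples V r" using o tuples_nth[OF u t] by (simp add: tuples_def)
          then have "sgn t \<odot>\<^bsub>?P\<^esub> ?m (omit t u @ [u ! t]) w
              = pure_tensor (ext_power V r) (sym_power V j)
                  (sgn t \<odot>\<^bsub>ext_power V r\<^esub> wedge V (omit t u @ [u ! t])) (sym_prod V w)"
            by (intro lin_smult[OF bilin_left[OF bilin_ext_sym[OF V] sym_prod_closed[OF V w]], symmetric]
                wedge_closed V)
          then show ?thesis
            unfolding sgn_def x_def
            by (simp only: alternating_omit_append[OF alternating_wedge[OF V] V vs_ext_power[OF V] u t])
        qed
        have m_last: "?m (omit t u @ [u ! t]) w \<in> carrier ?P"
          using o w tuples_nth[OF u t] by (intro ext_sym_monomial_closed V) (simp_all add: tuples_def)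
        have "phi V (r - 1) (j + 1) (ext_sym_monomial V (r - 1) (j + 1) (omit t u) (u ! t # w))
            = (\<Oplus>\<^bsub>?P\<^esub>s\<in>{..<Suc (length w)}. ?f s)"
          using phi_monomial[OF V o c] by simp
        also have "\<dots> = ?f 0 \<oplus>\<^bsub>?P\<^esub> (\<Oplus>\<^bsub>?P\<^esub>s\<in>{..<length w}. ?f (Suc s))"
        proof (rule P.finsum_lessThan_Suc_shift, rule funcsetI)
          fix s assume "s \<in> {..<Suc (length w)}"
          then show "?f s \<in> carrier ?P"
            using m_last m_closed[OF t] by (cases s) (simp_all add: omit_Cons)
        qed
        also have "\<dots> = ?m (omit t u @ [u ! t]) w
            \<oplus>\<^bsub>?P\<^esub> (\<Oplus>\<^bsub>?P\<^esub>s\<in>{..<length w}. ?m (omit t u @ [w ! s]) (u ! t # omit s w))"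
          by (simp add: omit_Cons)
        finally have eq: "phi V (r - 1) (j + 1) (ext_sym_monomial V (r - 1) (j + 1) (omit t u) (u ! t # w))
            = \<dots>" .
        have "phi V (r - 1) (j + 1) (sgn t \<odot>\<^bsub>?K\<^esub> ext_sym_monomial V (r - 1) (j + 1) (omit t u) (u ! t # w))
            = sgn t \<odot>\<^bsub>?P\<^esub> phi V (r - 1) (j + 1) (ext_sym_monomial V (r - 1) (j + 1) (omit t u) (u ! t # w))"
          by (rule lin_smult[OF \<phi>' ext_sym_monomial_closed[OF V o c]])
        also have "\<dots> = sgn t \<odot>\<^bsub>?P\<^esub> ?m (omit t u @ [u ! t]) w \<oplus>\<^bsub>?P\<^esub>
            sgn t \<odot>\<^bsub>?P\<^esub> (\<Oplus>\<^bsub>?P\<^esub>s\<in>{..<length w}. ?m (omit t u @ [w ! s]) (u ! t # omit s w))"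
          unfolding eq using m_closed[OF t]
          by (intro vs_smult_add_right P m_last P.finsum_closed funcsetI) simp
        also have "\<dots> = x \<oplus>\<^bsub>?P\<^esub> (\<Oplus>\<^bsub>?P\<^esub>s\<in>{..<length w}. A t s)"
          unfolding last A_def using m_closed[OF t] by (subst vs_smult_finsum[OF P]) auto
        finally show ?thesis .
      qed
      have mem: "ext_sym_monomial V (r - 1) (j + 1) (omit t u) (u ! t # w) \<in> carrier ?K"
        if "t < length u" for t
        using omit_tuples[OF u that] tuples_nth[OF u that] w
        by (intro ext_sym_monomial_closed V) (simp_all add: tuples_def)
      have "phi V (r - 1) (j + 1) (koszul V j r x) = (\<Oplus>\<^bsub>?P\<^esub>t\<in>{..<length u}.
          phi V (r - 1) (j + 1) (sgn t \<odot>\<^bsub>?K\<^esub> ext_sym_monomial V (r - 1) (j + 1) (omit t u) (u ! t # w)))"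
        unfolding x_def koszul_monomial[OF V u w] sgn_def
        using mem by (intro lin_finsum[OF \<phi>'] funcsetI vs_smult_closed vs_ext_sym V) simp
      also have "\<dots> = (\<Oplus>\<^bsub>?P\<^esub>t\<in>{..<length u}. x \<oplus>\<^bsub>?P\<^esub> (\<Oplus>\<^bsub>?P\<^esub>s\<in>{..<length w}. A t s))"
        by (rule P.finsum_cong'[OF refl _ term_eq]) (use x A in auto)
      also have "\<dots> = (\<Oplus>\<^bsub>?P\<^esub>t\<in>{..<length u}. x) \<oplus>\<^bsub>?P\<^esub>
          (\<Oplus>\<^bsub>?P\<^esub>t\<in>{..<length u}. \<Oplus>\<^bsub>?P\<^esub>s\<in>{..<length w}. A t s)"
        by (rule P.finsum_addf) (use x A in auto)
      finally show ?thesis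
        by (simp only: vs_finsum_const[OF P x])
    qed

    have koszul_phi: "koszul V (j - 1) (r + 1) (phi V r j x)
        = (- 1) \<odot>\<^bsub>?P\<^esub> (\<Oplus>\<^bsub>?P\<^esub>s\<in>{..<length w}. \<Oplus>\<^bsub>?P\<^esub>t\<in>{..<length u}. A t s)
          \<oplus>\<^bsub>?P\<^esub> of_nat (length w) \<odot>\<^bsub>?P\<^esub> x"
    proof -
      have term_eq: "koszul V (j - 1) (r + 1) (ext_sym_monomial V (r + 1) (j - 1) (u @ [w ! s]) (omit s w))
          = (- 1) \<odot>\<^bsub>?P\<^esub> (\<Oplus>\<^bsub>?P\<^esub>t\<in>{..<length u}. A t s) \<oplus>\<^bsub>?P\<^esub> x" if s: "s < length w" for s
      proof -
        let ?u = "u @ [w ! s]"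
        have o: "omit s w \<in> tuples V (j - 1)" by (rule omit_tuples[OF w s])
        have c: "?u \<in> tuples V (r + 1)" using tuples_nth[OF w s] u by (simp add: tuples_def)
        let ?f = "\<lambda>t. (- 1) ^ (length ?u - Suc t) \<odot>\<^bsub>?P\<^esub> ?m (omit t ?u) (?u ! t # omit s w)"
        have init: "?f t = (- 1) \<odot>\<^bsub>?P\<^esub> A t s" if t: "t < length u" for t
        proof -
          have "omit t ?u = omit t u @ [w ! s]" using t by (simp add: omit_def)
          moreover have "length ?u - Suc t = Suc (length u - Suc t)" using t by simp
          moreover have "?u ! t = u ! t" using t by (simp add: nth_append)
          ultimately show ?thesis
            using m_closed[OF t s] P by (simp add: A_def sgn_def vs_smult_assoc)
        qed
        \<comment> \<open>\<open>\<kappa>\<close> takes the vector that \<open>\<phi>\<close> has just put at the end of \<open>u\<close>\<close>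
        have last: "?f (length u) = x"
        proof -
          have "w ! s # omit s w \<in> tuples V j"
            using o tuples_nth[OF w s] by (simp add: tuples_def)
          moreover have "mset (w ! s # omit s w) = mset w"
            using s by (simp add: mset_omit)
          ultimately have "sym_prod V (w ! s # omit s w) = sym_prod V w"
            by (rule symmetric_mset[OF symmetric_sym_prod[OF V]])
          then show ?thesis
            using x P by (simp add: x_def omit_def)
        qed
        have "koszul V (j - 1) (r + 1) (ext_sym_monomial V (r + 1) (j - 1) ?u (omit s w))
            = (\<Oplus>\<^bsub>?P\<^esub>t\<in>{..<Suc (length u)}. ?f t)"
          using koszul_monomial[OF V c o] by simp
        also have "\<dots> = (\<Oplus>\<^bsub>?P\<^esub>t\<in>{..<length u}. ?f t) \<oplus>\<^bsub>?P\<^esub> ?f (length u)"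
        proof (rule P.finsum_lessThan_Suc, rule funcsetI)
          fix t assume "t \<in> {..<Suc (length u)}"
          then consider "t < length u" | "t = length u" by fastforce
          then show "?f t \<in> carrier ?P"
            by cases (simp_all only: init last x A[OF _ s] vs_smult_closed[OF P])
        qed
        also have "(\<Oplus>\<^bsub>?P\<^esub>t\<in>{..<length u}. ?f t) = (\<Oplus>\<^bsub>?P\<^esub>t\<in>{..<length u}. (- 1) \<odot>\<^bsub>?P\<^esub> A t s)"
          by (rule P.finsum_cong'[OF refl _ init]) (use A s P in auto)
        also have "\<dots> = (- 1) \<odot>\<^bsub>?P\<^esub> (\<Oplus>\<^bsub>?P\<^esub>t\<in>{..<length u}. A t s)"
          using A s by (intro vs_smult_finsum[OF P, symmetric]) auto
        finally show ?thesis unfolding last .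
      qed
      have mem: "ext_sym_monomial V (r + 1) (j - 1) (u @ [w ! s]) (omit s w) \<in> carrier ?F"
        if "s < length w" for s
        using omit_tuples[OF w that] tuples_nth[OF w that] u
        by (intro ext_sym_monomial_closed V) (simp_all add: tuples_def)
      have sum_A: "(\<Oplus>\<^bsub>?P\<^esub>t\<in>{..<length u}. A t s) \<in> carrier ?P" if "s < length w" for s
        using A that by (intro P.finsum_closed) auto
      have "koszul V (j - 1) (r + 1) (phi V r j x) = (\<Oplus>\<^bsub>?P\<^esub>s\<in>{..<length w}.
          koszul V (j - 1) (r + 1) (ext_sym_monomial V (r + 1) (j - 1) (u @ [w ! s]) (omit s w)))"
        unfolding x_def phi_monomial[OF V u w]
        using mem by (intro lin_finsum[OF \<kappa>'] funcsetI) simp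
      also have "\<dots> = (\<Oplus>\<^bsub>?P\<^esub>s\<in>{..<length w}. (- 1) \<odot>\<^bsub>?P\<^esub> (\<Oplus>\<^bsub>?P\<^esub>t\<in>{..<length u}. A t s) \<oplus>\<^bsub>?P\<^esub> x)"
        by (rule P.finsum_cong'[OF refl _ term_eq]) (use x sum_A P in auto)
      also have "\<dots> = (\<Oplus>\<^bsub>?P\<^esub>s\<in>{..<length w}. (- 1) \<odot>\<^bsub>?P\<^esub> (\<Oplus>\<^bsub>?P\<^esub>t\<in>{..<length u}. A t s))
          \<oplus>\<^bsub>?P\<^esub> (\<Oplus>\<^bsub>?P\<^esub>s\<in>{..<length w}. x)"
        by (rule P.finsum_addf) (use x sum_A P in auto)
      also have "(\<Oplus>\<^bsub>?P\<^esub>s\<in>{..<length w}. (- 1) \<odot>\<^bsub>?P\<^esub> (\<Oplus>\<^bsub>?P\<^esub>t\<in>{..<length u}. A t s))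
          = (- 1) \<odot>\<^bsub>?P\<^esub> (\<Oplus>\<^bsub>?P\<^esub>s\<in>{..<length w}. \<Oplus>\<^bsub>?P\<^esub>t\<in>{..<length u}. A t s)"
        using sum_A by (intro vs_smult_finsum[OF P, symmetric]) auto
      finally show ?thesis
        by (simp only: vs_finsum_const[OF P x])
    qed

    define B where "B = (\<Oplus>\<^bsub>?P\<^esub>t\<in>{..<length u}. \<Oplus>\<^bsub>?P\<^esub>s\<in>{..<length w}. A t s)"
    have B: "B \<in> carrier ?P"
      unfolding B_def using A by (intro P.finsum_closed funcsetI) auto
    have swap: "(\<Oplus>\<^bsub>?P\<^esub>s\<in>{..<length w}. \<Oplus>\<^bsub>?P\<^esub>t\<in>{..<length u}. A t s) = B"
      unfolding B_def using A by (intro P.finsum_swap) auto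
    have "phi V (r - 1) (j + 1) (koszul V j r x) \<oplus>\<^bsub>?P\<^esub> koszul V (j - 1) (r + 1) (phi V r j x)
        = (of_nat (length u) \<odot>\<^bsub>?P\<^esub> x \<oplus>\<^bsub>?P\<^esub> B) \<oplus>\<^bsub>?P\<^esub> (\<ominus>\<^bsub>?P\<^esub> B \<oplus>\<^bsub>?P\<^esub> of_nat (length w) \<odot>\<^bsub>?P\<^esub> x)"
      unfolding phi_koszul koszul_phi swap B_def[symmetric] using B P by (simp add: vs_neg_eq_smult)
    also have "\<dots> = of_nat (length u) \<odot>\<^bsub>?P\<^esub> x \<oplus>\<^bsub>?P\<^esub> of_nat (length w) \<odot>\<^bsub>?P\<^esub> x"
      using B x P by (simp add: P.a_assoc P.r_neg2)
    also have "\<dots> = of_int (r + j) \<odot>\<^bsub>?P\<^esub> x"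
    proof -
      have "of_nat (length u) + of_nat (length w) = (of_int (r + j) :: 'k)"
        using u w by (auto simp: tuples_def)
      then show ?thesis
        using x P by (simp only: vs_smult_add_left[symmetric])
    qed
    finally show "phi V (r - 1) (j + 1) (koszul V j r (?m u w))
        \<oplus>\<^bsub>?P\<^esub> koszul V (j - 1) (r + 1) (phi V r j (?m u w)) = of_int (r + j) \<odot>\<^bsub>?P\<^esub> ?m u w"
      by (simp only: x_def)
  qed
qed

section \<open>Descent to hook Schur modules\<close>

lemma koszul_image_submodule:
  assumes V: "vspace V"
  shows "LinearCombinations.submodule class_ring (koszul_image V (a - 2) (b + 2)) (ext_sym V (b + 1) (a - 1))"
proof -
  have "b + 2 - 1 = b + 1" "a - 2 + 1 = a - 1" by simp_all
  then show ?thesis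
    using lin_image_submodule[OF lin_koszul[OF V, of "b + 2" "a - 2"]]
    by (simp only: koszul_image_def)
qed

text \<open>
  If the total degree vanishes in the field, then the homotopy identity says that \<open>\<phi>\<close> and \<open>\<kappa>\<close> anticommute.
\<close>

lemma phi_koszul_image:
  fixes V :: "('k::field, 'v) module"
  assumes V: "vspace V" and ab: "(of_int (a + b) :: 'k) = 0" and y: "y \<in> koszul_image V (a - 2) (b + 2)"
  shows "phi V (b + 1) (a - 1) y \<in> koszul_image V (a - 1 - 2) (b + 1 + 2)"
proof -
  let ?P = "ext_sym V (b + 2) (a - 2)" and ?I = "koszul_image V (a - 1 - 2) (b + 1 + 2)"
  have P: "vspace ?P" by (rule vs_ext_sym[OF V])
  interpret P: abelian_group ?P by (rule vs_abelian_group[OF P])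
  obtain z where z: "z \<in> carrier ?P" and y: "y = koszul V (a - 2) (b + 2) z"
    using y by (auto simp: koszul_image_def)
  define k where "k = koszul V (a - 2 - 1) (b + 2 + 1) (phi V (b + 2) (a - 2) z)"
  have deg: "b + 2 - 1 = b + 1" "a - 2 + 1 = a - 1" "b + 2 + 1 = b + 1 + 2" "a - 2 - 1 = a - 1 - 2"
    "b + 1 + 1 = b + 2" "a - 1 - 1 = a - 2"
    by simp_all
  have "phi V (b + 2) (a - 2) z \<in> carrier (ext_sym V (b + 2 + 1) (a - 2 - 1))"
    by (rule lin_closed[OF lin_phi[OF V] z])
  then have k: "k \<in> ?I"
    unfolding k_def koszul_image_def deg by (rule imageI)
  have I: "LinearCombinations.submodule class_ring ?I ?P"
    using koszul_image_submodule[OF V, of "a - 1" "b + 1"] by (simp only: deg)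
  have sum: "phi V (b + 1) (a - 1) y \<oplus>\<^bsub>?P\<^esub> k = \<zero>\<^bsub>?P\<^esub>"
  proof -
    have "(of_int (b + 2 + (a - 2)) :: 'k) = 0" using ab by (simp add: add.commute)
    then show ?thesis
      using koszul_phi_homotopy[OF V z] z P by (simp only: y k_def deg(1,2) vs_smult_zero_left)
  qed
  have k': "k \<in> carrier ?P"
    using k I by (auto simp: submodule_def)
  have "y \<in> carrier (ext_sym V (b + 1) (a - 1))"
    using lin_closed[OF lin_koszul[OF V] z] by (simp only: y deg)
  then have "phi V (b + 1) (a - 1) y \<in> carrier ?P"
    using lin_closed[OF lin_phi[OF V, of "b + 1" "a - 1"]] by (simp only: deg)
  then have "phi V (b + 1) (a - 1) y = \<ominus>\<^bsub>?P\<^esub> k"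
    using sum k' by (metis P.minus_equality)
  also have "\<dots> = (- 1) \<odot>\<^bsub>?P\<^esub> k" by (rule vs_neg_eq_smult[OF P k'])
  also have "\<dots> \<in> ?I"
    using I k by (simp add: submodule_def)
  finally show ?thesis .
qed

theorem proposition3p3:
  fixes V :: "('k::field, 'v) module" and p m i :: nat
  assumes "CHAR('k) = p" and "p > 0"
    and "vectorspace class_ring V" and "vectorspace.fin_dim class_ring V"
    and "m > 0" and "p dvd m"
  shows "\<exists>\<Phi>. linear_map class_ring
                (hook_schur V (int m - int i) (int i))
                (hook_schur V (int m - int i - 1) (int i + 1)) \<Phi> \<and>
           (\<forall>x \<in> carrier (ext_sym V (int i + 1) (int m - int i - 1)).
              \<Phi> (hook_proj V (int m - int i) (int i) x) =
              hook_proj V (int m - int i - 1) (int i + 1)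
                (phi V (int i + 1) (int m - int i - 1) x))"
proof -
  note V = assms(3)
  define a b where "a = int m - int i" and "b = int i"
  let ?M = "ext_sym V (b + 1) (a - 1)" and ?N = "koszul_image V (a - 2) (b + 2)"
    and ?M' = "ext_sym V (b + 1 + 1) (a - 1 - 1)" and ?N' = "koszul_image V (a - 1 - 2) (b + 1 + 2)"
  have M: "vspace ?M" and M': "vspace ?M'" by (rule vs_ext_sym[OF V])+
  note N = koszul_image_submodule[OF V, of a b] and N' = koszul_image_submodule[OF V, of "a - 1" "b + 1"]
  have "(of_nat m :: 'k) = 0"
    using assms(1,6) by (simp add: of_nat_eq_0_iff_char_dvd)
  then have ab: "(of_int (a + b) :: 'k) = 0"
    by (simp add: a_def b_def)
  let ?f = "\<lambda>x. ?N' +>\<^bsub>?M'\<^esub> phi V (b + 1) (a - 1) x"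
  have f: "lin ?M (quotient_module ?M' ?N') ?f"
    by (rule lin_comp[OF lin_phi[OF V] lin_quotient[OF M' N']])
  have zero: "?f y = \<zero>\<^bsub>quotient_module ?M' ?N'\<^esub>" if y: "y \<in> ?N" for y
  proof -
    have "y \<in> carrier ?M" using y N by (auto simp: submodule_def)
    then show ?thesis
      using phi_koszul_image[OF V ab y] coset_eq_zero_iff[OF M' N' lin_closed[OF lin_phi[OF V]]]
      by (simp only:)
  qed
  have "lin (hook_schur V a b) (hook_schur V (a - 1) (b + 1)) (\<lambda>C. the_elem (?f ` C))"
    unfolding hook_schur_def by (rule lin_quotient_lift[OF M N f zero])
  moreover have "the_elem (?f ` hook_proj V a b x) = hook_proj V (a - 1) (b + 1) (phi V (b + 1) (a - 1) x)"
    if "x \<in> carrier ?M" for x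
    unfolding hook_proj_def by (rule the_elem_coset[OF M N f zero that])
  ultimately show ?thesis
    unfolding a_def b_def by blast
qed

end
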